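(* Let $\alpha,\beta,k\ge 0$ be integers. For every integer $n\ge 0$, $$p_{3^{2\alpha+1},3}\left(3^{2\alpha+\beta+1}n+\frac{4\cdot 3^{2\alpha+\beta+1}+3^{2\alpha+1}+1}{8}\right)\equiv 0\pmod{3^{3\alpha+\beta+2}}.$$ Moreover, if $p$ is a prime with $\left(\frac{-3}{p}\right)=-1$ and $n\ge 0$ is an integer with $p\nmid n$, then $$p_{3^{2\alpha+1},3}\left(3^{2\alpha+\beta+1}p^{2k+1}n+\frac{4p^{2k+2}\cdot 3^{2\alpha+\beta+1}+3^{2\alpha+1}+1}{8}\right)\equiv 0\pmod{3^{3\alpha+\beta+4}}.$$
   Context: $E(q^r)=\prod_{m\ge 1}(1-q^{rm})$. For a positive integer $\ell$, $p_{\ell,3}(n)$ (the number of 2-color partition triples of $n$ in which one of the colors appears only in parts that are multiples of $\ell$) is defined by $\sum_{n\ge 0}p_{\ell,3}(n)q^n=\dfrac{1}{E(q)^3E(q^\ell)^3}$. $\left(\frac{\cdot}{p}\right)$ is the Legendre symbol (so $p$ is an odd prime). *)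

theory Defs
  imports
    "HOL-Analysis.Analysis"
    "HOL-Computational_Algebra.Computational_Algebra"
    "HOL-Number_Theory.Number_Theory"
begin

(* The product is taken in the topology of coefficientwise stabilisation on formal power series,
   and the index m - 1 of the factor 1 - q^(rm) starts at 0.  It converges for r > 0 only. *)
definition eulerE :: "nat \<Rightarrow> int fps" where
  "eulerE r = (\<Prod>m. 1 - fps_X ^ (r * (m + 1)))"

(* The type int has no field inverse, so the reciprocal is the library's inverse of a power series
   with respect to a given inverse (here 1) of its constant coefficient. *)
definition p3 :: "nat \<Rightarrow> nat \<Rightarrow> int" where
  "p3 l n = fps_nth (fps_right_inverse (eulerE 1 ^ 3 * eulerE l ^ 3) 1) n"

lemma eulerE_partial_nth:
  assumes "r > 0" "k \<le> N"
  shows "fps_nth (\<Prod>i\<le>N. 1 - fps_X ^ (r * (i + 1)) :: int fps) k =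
         fps_nth (\<Prod>i\<le>k. 1 - fps_X ^ (r * (i + 1))) k"
  using assms(2)
proof (induction N rule: dec_induct)
  case (step N)
  have "N + 2 \<le> r * (N + 2)" using mult_le_mono1[of 1 r "N + 2"] assms(1) by simp
  hence "k < r * (N + 2)" using step.hyps by linarith
  thus ?case using step.IH by (simp add: algebra_simps fps_X_power_mult_nth)
qed simp

lemma eulerE_has_prod_and_nth_0:
  assumes "r > 0"
  shows "(\<lambda>m. 1 - fps_X ^ (r * (m + 1))) has_prod eulerE r \<and> fps_nth (eulerE r) 0 = 1"
proof -
  define f :: "nat \<Rightarrow> int fps" where "f = (\<lambda>m. 1 - fps_X ^ (r * (m + 1)))"
  define G where "G = Abs_fps (\<lambda>k. fps_nth (\<Prod>i\<le>k. f i) k)"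
  have G0: "fps_nth G 0 = 1" using assms by (simp add: G_def f_def)
  hence "G \<noteq> 0" by (metis fps_zero_nth zero_neq_one)
  moreover have "(\<lambda>n. \<Prod>i\<le>n. f i) \<longlonglongrightarrow> G"
  proof (rule tendsto_fpsI)
    fix k
    show "\<forall>\<^sub>F N in sequentially. fps_nth (\<Prod>i\<le>N. f i) k = fps_nth G k"
      using eventually_ge_at_top[of k]
    proof eventually_elim
      case (elim N)
      show ?case unfolding G_def f_def fps_nth_Abs_fps by (rule eulerE_partial_nth[OF assms elim])
    qed
  qed
  ultimately have "f has_prod G" by (simp add: has_prod_def raw_has_prod_def)
  moreover from this have "eulerE r = G"
    unfolding eulerE_def f_def by (rule has_prod_unique[symmetric])
  ultimately show ?thesis using G0 by (simp add: f_def)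
qed

lemma p3_generating_function:
  assumes "l > 0"
  shows "eulerE 1 ^ 3 * eulerE l ^ 3 * Abs_fps (p3 l) = 1"
proof -
  have "fps_nth (eulerE 1 ^ 3 * eulerE l ^ 3) 0 * 1 = 1"
    using eulerE_has_prod_and_nth_0[of 1] eulerE_has_prod_and_nth_0[OF assms]
    by (simp add: fps_nth_power_0)
  note fps_right_inverse[OF this]
  moreover have "fps_right_inverse (eulerE 1 ^ 3 * eulerE l ^ 3) 1 = Abs_fps (p3 l)"
    by (rule fps_ext) (simp add: p3_def)
  ultimately show ?thesis by metis
qed

lemma eight_dvd_index:
  fixes a b m k :: nat
  assumes "odd a" "odd m"
  shows "8 dvd 4 * m ^ (2 * k + 2) * 3 ^ b + 3 ^ a + (1::nat)"
proof -
  obtain c where a: "a = 2 * c + 1" using assms(1) by (rule oddE)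
  have "[(9::nat) ^ c = 1 ^ c] (mod 8)" by (rule cong_pow) (simp add: cong_def)
  hence "[3 * (9::nat) ^ c = 3 * 1] (mod 8)" by (metis cong_scalar_left power_one)
  hence "[(3::nat) ^ a = 3] (mod 8)" by (simp add: a power_mult)
  hence A: "(3::nat) ^ a mod 8 = 3" by (simp add: cong_def)
  have "odd (m ^ (2 * k + 2) * 3 ^ b)" using assms(2) by simp
  then obtain d where "m ^ (2 * k + 2) * 3 ^ b = 2 * d + 1" by (rule oddE)
  hence "4 * m ^ (2 * k + 2) * 3 ^ b = 8 * d + 4" by (simp add: mult.assoc)
  moreover have "8 dvd 8 * d + 4 + x + 1" if "x mod 8 = 3" for x :: nat
    using that by presburger
  ultimately show ?thesis using A by metis
qed

end

theory Submission
  imports Defs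
begin

text \<open>
  Put \<open>t = q E(q^3)^12 / E(q)^12\<close> and \<open>y = q E(q^9)^3 / E(q)^3\<close>. Jacobi's series for \<open>E(q)^3\<close> splits as
  \<open>A(q^3) - 3 q E(q^9)^3\<close>, and taking the norm over the cube roots of unity shows that \<open>y\<close> satisfies
  \<open>y^3 = \<tau> (1 + 9 y + 27 y^2)\<close> with \<open>\<tau> = t(q^3)\<close>, while \<open>y^4 = \<tau> t\<close>. Hence the operator
  \<open>\<Sum> f(n) q^n \<mapsto> \<Sum> f(3n) q^n\<close> acts on the polynomials in \<open>t\<close>, and on their products with
  \<open>q / E(q)^3\<close>, by recurrences whose coefficients have explicit 3-adic valuations. Starting from
  \<open>1 / E(q)^3\<close>, the first step yields \<open>9 t\<close>, each further step gains a factor 9 or 3 according to whether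
  \<open>q / E(q)^3\<close> is absent or present, and the coefficients of the higher powers of \<open>t\<close> stay divisible by 9 times more.
  So the series in the theorem is \<open>3^(3\<alpha>+\<beta>+2)\<close> times a series that is congruent modulo 9 to an
  integer multiple of \<open>E(q)^3 E(q^3)^3\<close>. By Jacobi's identity
  the exponents \<open>n\<close> of the latter satisfy \<open>8 n + 4 = x^2 + 3 y^2\<close>, and a prime \<open>p\<close> with
  \<open>(-3 | p) = -1\<close> divides such a number to an even power.
\<close>

section \<open>Jacobi's identity\<close>

definition tri :: "nat \<Rightarrow> nat" where
  "tri j = \<Sum>{..j}"

lemma tri_0 [simp]: "tri 0 = 0" and tri_Suc [simp]: "tri (Suc j) = tri j + Suc j"
  by (simp_all add: tri_def)

lemma eight_tri: "8 * tri j + 1 = (2 * j + 1)\<^sup>2"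
  by (induction j) (simp_all add: power2_eq_square algebra_simps)

lemma tri_ge: "j \<le> tri j"
  by (induction j) auto

lemma inj_tri: "inj tri"
  using eight_tri by (intro injI) (metis add_right_cancel mult_left_cancel numeral_neq_zero power2_eq_iff_nonneg zero_le)

section \<open>Gaussian binomials and a finite form of Jacobi's identity\<close>

definition qprod :: "nat \<Rightarrow> int fps" where
  "qprod n = (\<Prod>i<n. 1 - fps_X ^ (i + 1))"

lemma qprod_0 [simp]: "qprod 0 = 1"
  and qprod_Suc: "qprod (Suc n) = qprod n * (1 - fps_X ^ (n + 1))"
  by (simp_all add: qprod_def)

lemma qprod_nth_0: "qprod n $ 0 = 1"
  by (induction n) (simp_all add: qprod_Suc)

text \<open>Extending the reciprocals by \<open>0\<close> to negative indices keeps the recurrence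
  \<open>qprod_inv_pred\<close> valid at every index, so that no boundary terms occur below.\<close>

definition qprod_inv :: "int \<Rightarrow> int fps" where
  "qprod_inv k = (if k < 0 then 0 else fps_right_inverse (qprod (nat k)) 1)"

lemma qprod_mult_inv: "qprod n * qprod_inv (int n) = 1"
  using fps_right_inverse[of "qprod n" 1] by (simp add: qprod_inv_def qprod_nth_0)

lemma qprod_inv_pred: "qprod_inv (k - 1) = qprod_inv k * (1 - fps_X ^ nat k)"
proof (cases "k \<le> 0")
  case True
  then show ?thesis by (simp add: qprod_inv_def)
next
  case False
  then obtain m where k: "k = int (Suc m)" by (metis not_le zero_less_imp_eq_int gr0_implies_Suc)
  have "qprod_inv (int m) = qprod_inv (int m) * (qprod (Suc m) * qprod_inv (int (Suc m)))"
    by (simp only: qprod_mult_inv mult_1_right)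
  also have "\<dots> = (qprod m * qprod_inv (int m)) * (qprod_inv (int (Suc m)) * (1 - fps_X ^ (Suc m)))"
    by (simp add: qprod_Suc algebra_simps)
  also have "\<dots> = qprod_inv (int (Suc m)) * (1 - fps_X ^ (Suc m))"
    by (simp only: qprod_mult_inv mult_1_left)
  finally have "qprod_inv (int m) = \<dots>" .
  moreover have "int (Suc m) - 1 = int m" by simp
  ultimately show ?thesis unfolding k nat_int by (simp only:)
qed

text \<open>Up to the sign and the power of q this is the Gaussian binomial coefficient of 2n + 1
  over n - j. It vanishes for j > n by the convention for \<open>qprod_inv\<close>.\<close>

definition jac :: "nat \<Rightarrow> nat \<Rightarrow> int fps" where
  "jac n j = (- 1) ^ j * fps_X ^ tri j * qprod (2 * n + 1)
     * qprod_inv (int n - int j) * qprod_inv (int n + 1 + int j)"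

text \<open>The q-Pascal rule applied twice, with denominators cleared. For a = 0 or b = 0 the
  truncated subtraction is harmless, as it stands next to a vanishing factor.\<close>

lemma q_trinomial_identity:
  fixes q :: "'a :: comm_ring_1"
  assumes "a + b = 2 * n + 3"
  shows "(1 - q ^ (2 * n + 2)) * (1 - q ^ (2 * n + 3)) =
    (1 + q ^ (2 * n + 2)) * (1 - q ^ a) * (1 - q ^ b)
    + q ^ a * ((1 - q ^ b) * (1 - q ^ (b - 1)))
    + q ^ b * ((1 - q ^ a) * (1 - q ^ (a - 1)))"
proof (cases "a = 0 \<or> b = 0")
  case True
  with assms have "(a = 0 \<and> b = 2 * n + 3) \<or> (b = 0 \<and> a = 2 * n + 3)" by auto
  moreover have "2 * n + 3 - 1 = 2 * n + 2" by simp
  ultimately show ?thesis by (elim disjE conjE) (simp_all only: power_0 diff_self mult_zero_left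
    mult_zero_right mult_1_left add_0_left add_0_right mult.commute)
next
  case False
  then obtain a' b' where ab: "a = Suc a'" "b = Suc b'" by (metis not0_implies_Suc)
  have e: "2 * n + 2 = a' + b' + 1" "2 * n + 3 = a' + b' + 2" using assms ab by simp_all
  show ?thesis unfolding e ab by (simp add: algebra_simps power_add)
qed

lemma jac_core:
  assumes "a + b = 2 * n + 3"
  shows "qprod (2 * n + 3) * qprod_inv (int a) * qprod_inv (int b) =
     qprod (2 * n + 1) * ((1 + fps_X ^ (2 * n + 2)) * qprod_inv (int a - 1) * qprod_inv (int b - 1)
       + fps_X ^ a * qprod_inv (int a) * qprod_inv (int b - 2)
       + fps_X ^ b * qprod_inv (int a - 2) * qprod_inv (int b))"
proof -
  have pred2: "qprod_inv (int c - 2) = qprod_inv (int c) * (1 - fps_X ^ c) * (1 - fps_X ^ (c - 1))" for c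
    using qprod_inv_pred[of "int c - 1"] qprod_inv_pred[of "int c"]
    by (simp add: nat_diff_distrib')
  have Q: "qprod (2 * n + 3) = qprod (2 * n + 1) * (1 - fps_X ^ (2 * n + 2)) * (1 - fps_X ^ (2 * n + 3))"
    by (simp add: qprod_Suc eval_nat_numeral)
  note id = q_trinomial_identity[OF assms, of "fps_X :: int fps"]
  have regroup: "A * x * y * u * v = A * ((1 + s) * (u * f) * (v * g) + f' * u * (v * g * g') + g'' * (u * f * h) * v)"
    if "x * y = (1 + s) * f * g + f' * (g * g') + g'' * (f * h)" for A x y u v s f g f' g' g'' h :: "int fps"
  proof -
    have "A * x * y * u * v = A * u * v * (x * y)" by (simp add: ac_simps)
    also have "\<dots> = A * ((1 + s) * (u * f) * (v * g) + f' * u * (v * g * g') + g'' * (u * f * h) * v)"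
      unfolding that by (simp add: algebra_simps)
    finally show ?thesis .
  qed
  show ?thesis
    unfolding Q pred2 qprod_inv_pred nat_int
    using id by (rule regroup)
qed

lemma jac_rec_Suc:
  assumes "j \<le> n"
  shows "jac (Suc n) (Suc j) =
    (1 + fps_X ^ (2 * n + 2)) * jac n (Suc j) - fps_X ^ (n + 1) * (jac n j + jac n (j + 2))"
proof -
  \<comment> \<open>These are the indices of the two reciprocals in
    \<open>jac (Suc n) (Suc j)\<close>. The powers of q then match because of the increments of
    \<open>tri\<close>.\<close>
  define a b where "a = n - j" and "b = n + j + 3"
  have ab: "a + b = 2 * n + 3" using assms by (simp add: a_def b_def)
  have i: "int a = int n - int j" "int b = int n + int j + 3" using assms by (simp_all add: a_def b_def of_nat_diff)
  have J: "jac (Suc n) (Suc j) = - ((- 1) ^ j * fps_X ^ tri (Suc j) * (qprod (2 * n + 3)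
     * qprod_inv (int a) * qprod_inv (int b)))"
    unfolding jac_def i by (simp add: algebra_simps eval_nat_numeral)
  have J1: "jac n (Suc j) = - ((- 1) ^ j * fps_X ^ tri (Suc j) * qprod (2 * n + 1) * (qprod_inv (int a - 1) * qprod_inv (int b - 1)))"
    unfolding jac_def i by (simp add: algebra_simps)
  have "fps_X ^ (n + 1) * jac n j = (- 1) ^ j * (fps_X ^ (n + 1) * fps_X ^ tri j) * qprod (2 * n + 1) * (qprod_inv (int a) * qprod_inv (int b - 2))"
    unfolding jac_def i by (simp add: algebra_simps)
  also have "fps_X ^ (n + 1) * fps_X ^ tri j = (fps_X ^ a * fps_X ^ tri (Suc j) :: int fps)"
    unfolding power_add[symmetric] using assms by (intro arg_cong[of _ _ "power fps_X"]) (simp add: a_def)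
  finally have J2: "fps_X ^ (n + 1) * jac n j = (- 1) ^ j * (fps_X ^ a * fps_X ^ tri (Suc j)) * qprod (2 * n + 1) * (qprod_inv (int a) * qprod_inv (int b - 2))" .
  have "fps_X ^ (n + 1) * jac n (j + 2) = (- 1) ^ j * (fps_X ^ (n + 1) * fps_X ^ tri (j + 2)) * qprod (2 * n + 1) * (qprod_inv (int a - 2) * qprod_inv (int b))"
    unfolding jac_def i by (simp add: algebra_simps)
  also have "fps_X ^ (n + 1) * fps_X ^ tri (j + 2) = (fps_X ^ b * fps_X ^ tri (Suc j) :: int fps)"
    unfolding power_add[symmetric] by (intro arg_cong[of _ _ "power fps_X"]) (simp add: b_def eval_nat_numeral)
  finally have J3: "fps_X ^ (n + 1) * jac n (j + 2) = (- 1) ^ j * (fps_X ^ b * fps_X ^ tri (Suc j)) * qprod (2 * n + 1) * (qprod_inv (int a - 2) * qprod_inv (int b))" .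
  show ?thesis
    unfolding distrib_left J2 J3 J J1 jac_core[OF ab] by (simp add: algebra_simps)
qed

text \<open>The recurrence of \<open>jac_rec_Suc\<close> at j = -1: the formula for
  \<open>jac\<close> read at index -1 gives \<open>- jac n 0\<close>, hence the extra positive
  term.\<close>

lemma jac_rec_0:
  "jac (Suc n) 0 =
    (1 + fps_X ^ (2 * n + 2)) * jac n 0 + fps_X ^ (n + 1) * jac n 0 - fps_X ^ (n + 1) * jac n 1"
proof -
  have ab: "(n + 1) + (n + 2) = 2 * n + 3" by simp
  have J: "jac (Suc n) 0 = qprod (2 * n + 3) * qprod_inv (int (n + 1)) * qprod_inv (int (n + 2))"
    by (simp add: jac_def algebra_simps eval_nat_numeral)
  have J0: "jac n 0 = qprod (2 * n + 1) * (qprod_inv (int (n + 1) - 1) * qprod_inv (int (n + 2) - 1))"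
    and J0': "jac n 0 = qprod (2 * n + 1) * (qprod_inv (int (n + 1)) * qprod_inv (int (n + 2) - 2))"
    and J1: "jac n 1 = - (fps_X * qprod (2 * n + 1) * (qprod_inv (int (n + 1) - 2) * qprod_inv (int (n + 2))))"
    by (simp_all add: jac_def algebra_simps)
  have "jac (Suc n) 0 = (1 + fps_X ^ (2 * n + 2)) * (qprod (2 * n + 1) * (qprod_inv (int (n + 1) - 1) * qprod_inv (int (n + 2) - 1)))
     + fps_X ^ (n + 1) * (qprod (2 * n + 1) * (qprod_inv (int (n + 1)) * qprod_inv (int (n + 2) - 2)))
     - fps_X ^ (n + 1) * - (fps_X * qprod (2 * n + 1) * (qprod_inv (int (n + 1) - 2) * qprod_inv (int (n + 2))))"
    unfolding J jac_core[OF ab] by (simp add: algebra_simps)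
  then show ?thesis unfolding J0[symmetric] J0'[symmetric] J1[symmetric] .
qed

lemma jac_eq_0: "n < j \<Longrightarrow> jac n j = 0"
  by (simp add: jac_def qprod_inv_def)

text \<open>Since (2j - 1) + (2j + 3) = 2 (2j + 1), the recurrence multiplies the weighted sum by 1
  - 2r + r^2. The last two terms correct for the cut at N.\<close>

lemma weighted_sum_step:
  fixes c d :: "nat \<Rightarrow> 'a :: comm_ring_1"
  assumes "d 0 = (1 + r\<^sup>2) * c 0 + r * c 0 - r * c 1"
    and "\<And>j. j < N \<Longrightarrow> d (Suc j) = (1 + r\<^sup>2) * c (Suc j) - r * (c j + c (j + 2))"
  shows "(\<Sum>j\<le>N. of_nat (2 * j + 1) * d j) =
    (1 - r)\<^sup>2 * (\<Sum>j\<le>N. of_nat (2 * j + 1) * c j)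
    - r * of_nat (2 * N + 1) * c (Suc N) + r * of_nat (2 * N + 3) * c N"
  using assms(2)
proof (induction N)
  case 0
  then show ?case by (simp add: assms(1) power2_eq_square algebra_simps)
next
  case (Suc N)
  have IH: "(\<Sum>j\<le>N. of_nat (2 * j + 1) * d j) =
    (1 - r)\<^sup>2 * (\<Sum>j\<le>N. of_nat (2 * j + 1) * c j)
    - r * of_nat (2 * N + 1) * c (Suc N) + r * of_nat (2 * N + 3) * c N"
    using Suc by simp
  have d: "d (Suc N) = (1 + r\<^sup>2) * c (Suc N) - r * (c N + c (Suc (Suc N)))"
    using Suc.prems[of N] by simp
  show ?case
    unfolding sum.atMost_Suc IH d by (simp add: power2_eq_square algebra_simps)
qed

text \<open>A finite form of Jacobi's identity: \<open>(2j + 1)\<close> is the value at \<open>z = 1\<close> of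
  \<open>z^(-j) + \<dots> + z^j\<close> in the corresponding expansion of \<open>\<Prod>i\<le>n. (1 - z q^i) (1 - q^i / z)\<close>.\<close>

lemma finite_jacobi: "(\<Sum>j\<le>n. of_nat (2 * j + 1) * jac n j) = qprod n ^ 2"
proof (induction n)
  case 0
  have "qprod_inv 0 = 1" using qprod_mult_inv[of 0] by simp
  moreover have "qprod 1 * qprod_inv 1 = 1" using qprod_mult_inv[of 1] by simp
  ultimately show ?case by (simp add: jac_def)
next
  case (Suc n)
  define r :: "int fps" where "r = fps_X ^ (n + 1)"
  have r2: "r\<^sup>2 = fps_X ^ (2 * n + 2)" 
    unfolding r_def power_mult[symmetric] by (intro arg_cong[of _ _ "power fps_X"]) simp
  have "(\<Sum>j\<le>Suc n. of_nat (2 * j + 1) * jac (Suc n) j) =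
    (1 - r)\<^sup>2 * (\<Sum>j\<le>Suc n. of_nat (2 * j + 1) * jac n j)
    - r * of_nat (2 * Suc n + 1) * jac n (Suc (Suc n)) + r * of_nat (2 * Suc n + 3) * jac n (Suc n)"
  proof (rule weighted_sum_step)
    show "jac (Suc n) 0 = (1 + r\<^sup>2) * jac n 0 + r * jac n 0 - r * jac n 1"
      unfolding r2 unfolding r_def by (rule jac_rec_0)
    show "jac (Suc n) (Suc j) = (1 + r\<^sup>2) * jac n (Suc j) - r * (jac n j + jac n (j + 2))" if "j < Suc n" for j
      unfolding r2 unfolding r_def using that by (intro jac_rec_Suc) simp
  qed
  also have "\<dots> = (1 - r)\<^sup>2 * qprod n ^ 2" using Suc by (simp add: jac_eq_0)
  finally show ?case by (simp add: qprod_Suc r_def power_mult_distrib mult.commute)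
qed

section \<open>Congruence modulo q^(K+1), through which finite products replace infinite
  ones\<close>

definition agree :: "nat \<Rightarrow> 'a :: comm_ring_1 fps \<Rightarrow> 'a fps \<Rightarrow> bool" where
  "agree K f g \<longleftrightarrow> (\<forall>i\<le>K. f $ i = g $ i)"

lemma agree_refl [simp]: "agree K f f"
  by (simp add: agree_def)

lemma agree_sym: "agree K f g \<Longrightarrow> agree K g f"
  by (simp add: agree_def)

lemma agree_trans [trans]: "agree K f g \<Longrightarrow> agree K g h \<Longrightarrow> agree K f h"
  by (simp add: agree_def)

lemma agree_add: "agree K f g \<Longrightarrow> agree K f' g' \<Longrightarrow> agree K (f + f') (g + g')"
  and agree_diff: "agree K f g \<Longrightarrow> agree K f' g' \<Longrightarrow> agree K (f - f') (g - g')"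
  by (simp_all add: agree_def)

lemma agree_mult: "agree K f g \<Longrightarrow> agree K f' g' \<Longrightarrow> agree K (f * f') (g * g')"
  by (auto simp: agree_def fps_mult_nth intro!: sum.cong)

lemma agree_power: "agree K f g \<Longrightarrow> agree K (f ^ n) (g ^ n)"
  by (induction n) (auto intro: agree_mult)

lemma agree_sum: "(\<And>x. x \<in> S \<Longrightarrow> agree K (f x) (g x)) \<Longrightarrow> agree K (sum f S) (sum g S)"
  by (auto simp: agree_def fps_sum_nth intro!: sum.cong)

lemma agree_inverse:
  assumes "agree K f g" "f * f' = 1" "g * g' = 1"
  shows "agree K f' g'"
proof -
  have "agree K (f' * (g * g')) (f' * (f * g'))"
    using assms(1) by (intro agree_mult agree_refl) (rule agree_sym)
  moreover have "f' * (g * g') = f'" "f' * (f * g') = g'"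
    using assms(2,3) by (simp, metis mult.assoc mult.commute mult_1_left)
  ultimately show ?thesis by simp
qed

lemma fps_eqI_agree: "(\<And>K. agree K f g) \<Longrightarrow> f = g"
  by (auto simp: agree_def intro!: fps_ext)

lemma agree_X_power: "K < m \<Longrightarrow> agree K (fps_X ^ m * f) (fps_X ^ m * g)"
  by (simp add: agree_def fps_X_power_mult_nth)

definition eprod :: "nat \<Rightarrow> nat \<Rightarrow> int fps" where
  "eprod r n = (\<Prod>i<n. 1 - fps_X ^ (r * (i + 1)))"

lemma eprod_0 [simp]: "eprod r 0 = 1"
  and eprod_Suc: "eprod r (Suc n) = eprod r n * (1 - fps_X ^ (r * (n + 1)))"
  by (simp_all add: eprod_def)

lemma qprod_eq_eprod: "qprod n = eprod 1 n"
  by (simp add: qprod_def eprod_def)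

lemma eulerE_nth_0 [simp]: "r > 0 \<Longrightarrow> eulerE r $ 0 = 1"
  using eulerE_has_prod_and_nth_0 by blast

lemma agree_eprod:
  assumes "r > 0" "K \<le> n"
  shows "agree K (eprod r n) (eulerE r)"
  unfolding agree_def
proof (intro allI impI)
  fix k assume k: "k \<le> K"
  have "eulerE r \<noteq> 0" using eulerE_nth_0[OF assms(1)] by (metis fps_zero_nth zero_neq_one)
  then have "(\<lambda>n. \<Prod>i\<le>n. 1 - fps_X ^ (r * (i + 1))) \<longlonglongrightarrow> eulerE r"
    using eulerE_has_prod_and_nth_0[OF assms(1)] by (auto simp: has_prod_def raw_has_prod_def)
  then have "eventually (\<lambda>n. fps_nth (\<Prod>i\<le>n. 1 - fps_X ^ (r * (i + 1))) k = eulerE r $ k) sequentially"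
    by (simp only: tendsto_fps_iff)
  then obtain M where M: "fps_nth (\<Prod>i\<le>n. 1 - fps_X ^ (r * (i + 1))) k = eulerE r $ k" if "n \<ge> M" for n
    by (auto simp: eventually_sequentially)
  have "(\<Prod>i\<le>n. 1 - fps_X ^ (r * (i + 1))) = eprod r (Suc n)"
    unfolding eprod_def lessThan_Suc_atMost ..
  also have "\<dots> = eprod r n - fps_X ^ (r * (n + 1)) * eprod r n"
    by (simp add: eprod_Suc algebra_simps)
  finally have P: "(\<Prod>i\<le>n. 1 - fps_X ^ (r * (i + 1))) = eprod r n - fps_X ^ (r * (n + 1)) * eprod r n" .
  have "n + 1 \<le> r * (n + 1)" using mult_le_mono1[of 1 r "n + 1"] assms(1) by simp
  then have "k < r * (n + 1)" using k assms(2) by linarith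
  then have "eprod r n $ k = (\<Prod>i\<le>n. 1 - fps_X ^ (r * (i + 1)) :: int fps) $ k"
    unfolding P by (simp add: fps_X_power_mult_nth)
  \<comment> \<open>At the index \<open>max k M\<close> the partial product has stabilised and also
    has the coefficient of the limit.\<close>
  also have "\<dots> = eulerE r $ k"
    using eulerE_partial_nth[OF assms(1), of k n] eulerE_partial_nth[OF assms(1), of k "max k M"]
      M[of "max k M"] k assms(2) by simp
  finally show "eprod r n $ k = eulerE r $ k" .
qed

text \<open>Multiply the finite identity at n = 2k by E(q). For j \<le> k every index in
  \<open>jac (2 * k) j\<close> is at least k, so up to degree k the products are E(q) or its
  reciprocal and cancel. For j > k the factor q^(tri j) has degree above k.\<close>

lemma jacobi_nth:
  "(eulerE 1 ^ 3) $ k = (\<Sum>j\<le>2 * k. if tri j = k then (- 1) ^ j * int (2 * j + 1) else 0)"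
proof -
  define e where "e = eulerE 1"
  define f where "f = fps_right_inverse e 1"
  have ef: "e * f = 1" unfolding f_def by (rule fps_right_inverse) (simp add: e_def)
  have Q: "agree k (qprod n) e" if "k \<le> n" for n
    unfolding qprod_eq_eprod e_def using that by (intro agree_eprod) simp_all
  have R: "agree k (qprod_inv (int n)) f" if "k \<le> n" for n
    by (rule agree_inverse[OF Q[OF that] qprod_mult_inv ef])
  have J: "agree k (e * jac (2 * k) j) ((- 1) ^ j * fps_X ^ tri j)" for j
  proof (cases "j \<le> k")
    case True
    have I: "int (2 * k) - int j = int (2 * k - j)" "int (2 * k) + 1 + int j = int (2 * k + 1 + j)"
      using True by (simp_all add: of_nat_diff)
    have "agree k (qprod_inv (int (2 * k) - int j)) f" "agree k (qprod_inv (int (2 * k) + 1 + int j)) f"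
      unfolding I using True by (intro R; simp)+
    moreover have "agree k (qprod (2 * (2 * k) + 1)) e" by (rule Q) simp
    ultimately have "agree k (e * jac (2 * k) j) (e * ((- 1) ^ j * fps_X ^ tri j * e * f * f))"
      unfolding jac_def by (intro agree_mult agree_refl)
    also have "e * ((- 1) ^ j * fps_X ^ tri j * e * f * f) = (- 1) ^ j * fps_X ^ tri j * (e * f) * (e * f)"
      by (simp only: ac_simps)
    finally show ?thesis by (simp add: ef)
  next
    case False
    then have "k < tri j" using tri_ge[of j] by simp
    then have "agree k (fps_X ^ tri j * (e * (- 1) ^ j * qprod (2 * (2 * k) + 1)
        * qprod_inv (int (2 * k) - int j) * qprod_inv (int (2 * k) + 1 + int j))) (fps_X ^ tri j * (- 1) ^ j)"
      by (rule agree_X_power)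
    then show ?thesis unfolding jac_def by (simp only: ac_simps)
  qed
  have "agree k (e ^ 3) (e * qprod (2 * k) ^ 2)"
    unfolding power3_eq_cube power2_eq_square mult.assoc
    by (intro agree_mult agree_refl agree_sym[OF Q]) simp_all
  also have "e * qprod (2 * k) ^ 2 = (\<Sum>j\<le>2 * k. of_nat (2 * j + 1) * (e * jac (2 * k) j))"
    unfolding finite_jacobi[symmetric] sum_distrib_left by (simp only: mult.left_commute)
  also have "agree k \<dots> (\<Sum>j\<le>2 * k. of_nat (2 * j + 1) * ((- 1) ^ j * fps_X ^ tri j))"
    by (intro agree_sum agree_mult agree_refl J)
  finally have "e ^ 3 $ k = (\<Sum>j\<le>2 * k. of_nat (2 * j + 1) * ((- 1) ^ j * fps_X ^ tri j)) $ k"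
    by (simp add: agree_def)
  also have "\<dots> = (\<Sum>j\<le>2 * k. if tri j = k then (- 1) ^ j * int (2 * j + 1) else 0)"
    unfolding fps_sum_nth
  proof (intro sum.cong refl)
    fix j
    have c: "of_nat (2 * j + 1) * (- 1) ^ j = (fps_const ((- 1) ^ j * int (2 * j + 1)) :: int fps)"
      by (simp flip: fps_of_nat fps_const_power fps_const_mult fps_const_neg fps_const_add add: algebra_simps)
    show "(of_nat (2 * j + 1) * ((- 1) ^ j * fps_X ^ tri j)) $ k =
       (if tri j = k then (- 1) ^ j * int (2 * j + 1) else 0)"
      unfolding mult.assoc[symmetric] c by (auto simp: fps_mult_left_const_nth)
  qed
  finally show ?thesis by (simp add: e_def)
qed

lemma jacobi_tri: "(eulerE 1 ^ 3) $ tri j = (- 1) ^ j * int (2 * j + 1)"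
proof -
  have "j \<le> 2 * tri j" using tri_ge[of j] by simp
  then show ?thesis
    unfolding jacobi_nth by (simp add: inj_eq[OF inj_tri])
qed

lemma jacobi_non_tri: "k \<notin> range tri \<Longrightarrow> (eulerE 1 ^ 3) $ k = 0"
  unfolding jacobi_nth by (intro sum.neutral) auto

section \<open>The cubic dissection of Jacobi's series\<close>

definition dil :: "nat \<Rightarrow> int fps \<Rightarrow> int fps" where
  "dil r f = f oo fps_X ^ r"

lemma dil_1 [simp]: "dil r 1 = 1"
  and dil_numeral [simp]: "dil r (numeral m) = numeral m"
  and dil_add [simp]: "dil r (f + g) = dil r f + dil r g"
  and dil_diff [simp]: "dil r (f - g) = dil r f - dil r g"
  by (simp_all add: dil_def fps_compose_add_distrib fps_compose_sub_distrib)

lemma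
  assumes "r > 0"
  shows dil_mult [simp]: "dil r (f * g) = dil r f * dil r g"
    and dil_power [simp]: "dil r (f ^ n) = dil r f ^ n"
    and dil_X [simp]: "dil r fps_X = fps_X ^ r"
    and dil_prod: "dil r (prod h S) = (\<Prod>x\<in>S. dil r (h x))"
  using assms by (simp_all add: dil_def fps_compose_mult_distrib fps_compose_power fps_compose_prod_distrib)

lemma dil_dil: "r > 0 \<Longrightarrow> s > 0 \<Longrightarrow> dil r (dil s f) = dil (r * s) f"
  by (simp add: dil_def fps_compose_assoc[symmetric] fps_X_power_compose power_mult)

lemma dil_nth:
  assumes "r > 0"
  shows "dil r f $ n = (if r dvd n then f $ (n div r) else 0)"
proof -
  have *: "f $ i * (fps_X ^ r) ^ i $ n = (if i = n div r then if r dvd n then f $ (n div r) else 0 else 0)" for i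
    using assms by (auto simp: power_mult[symmetric])
  show ?thesis
    unfolding dil_def fps_compose_nth * by (simp add: sum.delta)
qed

lemma agree_dil: "r > 0 \<Longrightarrow> agree K f g \<Longrightarrow> agree K (dil r f) (dil r g)"
  by (simp add: agree_def dil_nth) (meson div_le_dividend le_trans)

lemma dil_eulerE:
  assumes "r > 0"
  shows "dil r (eulerE 1) = eulerE r"
proof (rule fps_eqI_agree)
  fix K
  have "dil r (eprod 1 K) = eprod r K"
    unfolding eprod_def dil_prod[OF assms]
    by (simp only: dil_diff dil_1 dil_power[OF assms] dil_X[OF assms] power_mult power_one_right)
  then have "agree K (eprod r K) (dil r (eulerE 1))"
    using agree_dil[OF assms agree_eprod[of 1 K K]] by simp
  with agree_eprod[OF assms order_refl] show "agree K (dil r (eulerE 1)) (eulerE r)"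
    using agree_sym agree_trans by blast
qed

section \<open>Residue classes of exponents modulo 3 and the norm over cube roots of unity\<close>

definition res_part :: "nat \<Rightarrow> int fps \<Rightarrow> int fps" where
  "res_part i f = Abs_fps (\<lambda>n. if n mod 3 = i then f $ n else 0)"

lemma res_part_nth: "res_part i f $ n = (if n mod 3 = i then f $ n else 0)"
  by (simp add: res_part_def)

lemma res_part_add: "res_part i (f + g) = res_part i f + res_part i g"
  and res_part_diff: "res_part i (f - g) = res_part i f - res_part i g"
  by (simp_all add: fps_eq_iff res_part_nth)

lemma res_part_X_power: "res_part i (fps_X ^ m) = (if m mod 3 = i then fps_X ^ m else 0)"
  by (auto simp: fps_eq_iff res_part_nth)

lemma res_part_1: "res_part i 1 = (if i = 0 then 1 else 0)"
  by (auto simp: fps_eq_iff res_part_nth)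

lemma res_part_decomp: "f = res_part 0 f + res_part 1 f + res_part 2 f"
proof (rule fps_ext)
  fix n :: nat
  have "n mod 3 = 0 \<or> n mod 3 = 1 \<or> n mod 3 = 2" by presburger
  then show "f $ n = (res_part 0 f + res_part 1 f + res_part 2 f) $ n" by (auto simp: res_part_nth)
qed

lemma res_part_part_mult:
  "res_part k (res_part i f * res_part j g) = (if k = (i + j) mod 3 then res_part i f * res_part j g else 0)"
proof -
  have "(res_part i f * res_part j g) $ n = 0" if "n mod 3 \<noteq> (i + j) mod 3" for n
    unfolding fps_mult_nth
  proof (intro sum.neutral ballI)
    fix a assume "a \<in> {0..n}"
    then have "n = a + (n - a)" by simp
    then have "n mod 3 = (a mod 3 + (n - a) mod 3) mod 3" by (metis mod_add_eq)
    then show "res_part i f $ a * res_part j g $ (n - a) = 0"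
      using that by (auto simp: res_part_nth)
  qed
  then show ?thesis by (auto simp: fps_eq_iff res_part_nth)
qed

lemma res_part_mult:
  shows "res_part 0 (f * g) = res_part 0 f * res_part 0 g + res_part 1 f * res_part 2 g + res_part 2 f * res_part 1 g"
    and "res_part 1 (f * g) = res_part 0 f * res_part 1 g + res_part 1 f * res_part 0 g + res_part 2 f * res_part 2 g"
    and "res_part 2 (f * g) = res_part 0 f * res_part 2 g + res_part 2 f * res_part 0 g + res_part 1 f * res_part 1 g"
proof -
  have fg: "f * g = (res_part 0 f + res_part 1 f + res_part 2 f) * (res_part 0 g + res_part 1 g + res_part 2 g)"
    by (intro arg_cong2[of _ _ _ _ times] res_part_decomp)
  show "res_part 0 (f * g) = res_part 0 f * res_part 0 g + res_part 1 f * res_part 2 g + res_part 2 f * res_part 1 g"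
    and "res_part 1 (f * g) = res_part 0 f * res_part 1 g + res_part 1 f * res_part 0 g + res_part 2 f * res_part 2 g"
    and "res_part 2 (f * g) = res_part 0 f * res_part 2 g + res_part 2 f * res_part 0 g + res_part 1 f * res_part 1 g"
    unfolding fg distrib_left distrib_right res_part_add res_part_part_mult by simp_all
qed

text \<open>The product of \<open>f(\<omega>^j q)\<close> over the three cube roots of unity, written without \<open>\<omega>\<close>.\<close>

definition norm3 :: "int fps \<Rightarrow> int fps" where
  "norm3 f = res_part 0 f ^ 3 + res_part 1 f ^ 3 + res_part 2 f ^ 3 - 3 * res_part 0 f * res_part 1 f * res_part 2 f"

text \<open>Multiplicativity of the determinant of 3 by 3 circulant matrices. The determinant splits
  into a linear and a quadratic factor, and each of these is multiplicative by itself.\<close>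

lemma circulant_identity:
  fixes a b c x y z :: "'a :: comm_ring_1"
  defines "P \<equiv> a * x + b * z + c * y" and "Q \<equiv> a * y + b * x + c * z" and "R \<equiv> a * z + c * x + b * y"
  shows "P ^ 3 + Q ^ 3 + R ^ 3 - 3 * P * Q * R
    = (a ^ 3 + b ^ 3 + c ^ 3 - 3 * a * b * c) * (x ^ 3 + y ^ 3 + z ^ 3 - 3 * x * y * z)"
proof -
  have factor: "u ^ 3 + v ^ 3 + w ^ 3 - 3 * u * v * w
      = (u + v + w) * (u * (u - v) + v * (v - w) + w * (w - u))" for u v w :: 'a
    by (simp add: power3_eq_cube algebra_simps)
  have sum: "P + Q + R = (a + b + c) * (x + y + z)"
    by (simp add: P_def Q_def R_def algebra_simps)
  have quad: "P * (P - Q) + Q * (Q - R) + R * (R - P)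
      = (a * (a - b) + b * (b - c) + c * (c - a)) * (x * (x - y) + y * (y - z) + z * (z - x))"
    by (simp add: P_def Q_def R_def algebra_simps)
  show ?thesis
    unfolding factor sum quad by (simp only: ac_simps)
qed

lemma norm3_mult: "norm3 (f * g) = norm3 f * norm3 g"
  unfolding norm3_def res_part_mult by (rule circulant_identity)

lemma norm3_1: "norm3 1 = 1"
  by (simp add: norm3_def res_part_1)

lemma norm3_power: "norm3 (f ^ n) = norm3 f ^ n"
  by (induction n) (simp_all add: norm3_1 norm3_mult)

text \<open>If 3 does not divide m, then \<omega>^m is again a primitive cube root of unity and the
  three conjugates multiply to 1 - q^(3m); otherwise they coincide.\<close>

lemma norm3_factor:
  "norm3 (1 - fps_X ^ m) = (if 3 dvd m then (1 - fps_X ^ m) ^ 3 else 1 - fps_X ^ (3 * m))"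
proof -
  have c: "m mod 3 = 0 \<or> m mod 3 = 1 \<or> m mod 3 = 2" by presburger
  have "(fps_X ^ m) ^ 3 = (fps_X ^ (3 * m) :: int fps)"
    by (simp only: power_mult[symmetric] mult.commute)
  with c show ?thesis
    unfolding dvd_eq_mod_eq_0 norm3_def res_part_diff res_part_1 res_part_X_power
    by (elim disjE) simp_all
qed

lemma agree_norm3: "agree K f g \<Longrightarrow> agree K (norm3 f) (norm3 g)"
proof -
  assume "agree K f g"
  then have "agree K (res_part i f) (res_part i g)" for i
    by (simp add: agree_def res_part_nth)
  then show ?thesis
    unfolding norm3_def by (intro agree_add agree_diff agree_mult agree_power agree_refl)
qed

text \<open>The indices prime to 3 give the factors of \<open>eprod 3 (3 * n)\<close> except those
  with exponent divisible by 9, which \<open>eprod 9 n\<close> supplies. The multiples of 3 give the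
  cube of \<open>eprod 3 n\<close>.\<close>

lemma norm3_eprod: "norm3 (eprod 1 (3 * n)) * eprod 9 n = eprod 3 (3 * n) * eprod 3 n ^ 3"
proof (induction n)
  case 0
  then show ?case by (simp add: norm3_1)
next
  case (Suc n)
  define x y z w :: "int fps" where "x = 1 - fps_X ^ (9 * n + 3)" and "y = 1 - fps_X ^ (9 * n + 6)"
    and "z = 1 - fps_X ^ (9 * n + 9)" and "w = 1 - fps_X ^ (3 * n + 3)"
  have e: "3 * Suc n = Suc (Suc (Suc (3 * n)))" by simp
  have i: "1 * (3 * n + 1) = 3 * n + 1" "1 * (Suc (3 * n) + 1) = 3 * n + 2" "1 * (Suc (Suc (3 * n)) + 1) = 3 * n + 3"
    "3 * (3 * n + 1) = 9 * n + 3" "3 * (Suc (3 * n) + 1) = 9 * n + 6" "3 * (Suc (Suc (3 * n)) + 1) = 9 * n + 9"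
    "3 * (3 * n + 2) = 9 * n + 6" "3 * (n + 1) = 3 * n + 3" "9 * (n + 1) = 9 * n + 9"
    by simp_all
  have d: "\<not> 3 dvd 3 * n + 1" "\<not> 3 dvd 3 * n + 2" "3 dvd 3 * n + 3" by presburger+
  have "norm3 (eprod 1 (3 * Suc n)) = norm3 (eprod 1 (3 * n)) * x * y * w ^ 3"
    unfolding e eprod_Suc norm3_mult norm3_factor i x_def y_def w_def using d by simp
  moreover have "eprod 9 (Suc n) = eprod 9 n * z"
    unfolding eprod_Suc i z_def ..
  moreover have "eprod 3 (3 * Suc n) = eprod 3 (3 * n) * x * y * z"
    unfolding e eprod_Suc i x_def y_def z_def ..
  moreover have "eprod 3 (Suc n) = eprod 3 n * w"
    unfolding eprod_Suc i w_def ..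
  moreover have "norm3 (eprod 1 (3 * n)) * x * y * w ^ 3 * (eprod 9 n * z) =
     (norm3 (eprod 1 (3 * n)) * eprod 9 n) * (x * y * z * w ^ 3)"
    by (simp only: ac_simps)
  ultimately show ?case unfolding Suc.IH by (simp add: power_mult_distrib ac_simps)
qed

lemma norm3_eulerE: "norm3 (eulerE 1) * eulerE 9 = eulerE 3 ^ 4"
proof (rule fps_eqI_agree)
  fix K
  note ep = agree_eprod[where K = K]
  have *: "agree K (norm3 (eprod 1 (3 * K)) * eprod 9 K) (norm3 (eulerE 1) * eulerE 9)"
    "agree K (eprod 3 (3 * K) * eprod 3 K ^ 3) (eulerE 3 * eulerE 3 ^ 3)"
    by (intro agree_mult agree_norm3 agree_power ep; simp)+
  have "eulerE 3 * eulerE 3 ^ 3 = eulerE 3 ^ 4" by (simp add: eval_nat_numeral)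
  then show "agree K (norm3 (eulerE 1) * eulerE 9) (eulerE 3 ^ 4)"
    using agree_trans[OF agree_sym[OF *(1)[unfolded norm3_eprod]] *(2)] by (simp only:)
qed

section \<open>The operator U_3 (trisection) and the dissection of Jacobi's series\<close>

definition trisect :: "int fps \<Rightarrow> int fps" where
  "trisect f = Abs_fps (\<lambda>n. f $ (3 * n))"

lemma trisect_nth: "trisect f $ n = f $ (3 * n)"
  by (simp add: trisect_def)

lemma trisect_add [simp]: "trisect (f + g) = trisect f + trisect g"
  by (simp add: fps_eq_iff trisect_nth)

lemma res_part_0_eq: "res_part 0 f = dil 3 (trisect f)"
  by (auto simp: fps_eq_iff res_part_nth dil_nth trisect_nth)

definition eta3 :: "int fps" where
  "eta3 = eulerE 1 ^ 3"

lemma dil_eta3: "r > 0 \<Longrightarrow> dil r eta3 = eulerE r ^ 3"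
  unfolding eta3_def by (simp only: dil_power dil_eulerE)

lemma tri_mod_3: "tri (3 * m) mod 3 = 0" "tri (3 * m + 1) mod 3 = 1" "tri (3 * m + 2) mod 3 = 0"
proof -
  show *: "tri (3 * m) mod 3 = 0"
  proof (induction m)
    case (Suc m)
    have "tri (3 * Suc m) = tri (3 * m) + 3 * (3 * m + 2)" by (simp add: eval_nat_numeral)
    with Suc show ?case by presburger
  qed simp
  have "tri (3 * m + 1) = tri (3 * m) + (3 * m + 1)" "tri (3 * m + 2) = tri (3 * m) + 3 * (2 * m + 1)"
    by (simp_all add: eval_nat_numeral)
  with * show "tri (3 * m + 1) mod 3 = 1" "tri (3 * m + 2) mod 3 = 0" by presburger+
qed

lemma tri_3_1: "tri (3 * m + 1) = 9 * tri m + 1"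
  by (induction m) (simp_all add: eval_nat_numeral)

text \<open>Triangular numbers congruent to 1 modulo 3 come from j = 3m + 1 and equal 9 tri m + 1.
  Their coefficient is -3 times that of q^(tri m), as 2j + 1 = 3 (2m + 1) and the sign
  flips.\<close>

lemma eta3_part_1: "res_part 1 eta3 = - (3 * fps_X * dil 9 eta3)"
proof (rule fps_ext)
  fix n
  have tri_cases: "\<exists>m. j = 3 * m \<or> j = 3 * m + 1 \<or> j = 3 * m + 2" for j :: nat by presburger
  have R: "(- (3 * fps_X * dil 9 eta3)) $ n = (if n mod 9 = 1 then - 3 * eta3 $ (n div 9) else 0)"
  proof (cases n)
    case (Suc k)
    have "(n mod 9 = 1) = (9 dvd k)" "9 dvd k \<Longrightarrow> k div 9 = n div 9" using Suc by presburger+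
    then show ?thesis by (simp add: Suc mult.assoc dil_nth fps_numeral_fps_const fps_mult_left_const_nth)
  qed (simp add: mult.assoc fps_numeral_fps_const fps_mult_left_const_nth)
  show "res_part 1 eta3 $ n = (- (3 * fps_X * dil 9 eta3)) $ n"
  proof (cases "n \<in> range tri \<and> n mod 3 = 1")
    case True
    then obtain j where j: "n = tri j" by auto
    then obtain m where "j = 3 * m + 1" using tri_cases[of j] tri_mod_3[of m] True by (metis tri_mod_3 zero_neq_one)
    then have n: "n = 9 * tri m + 1" and n': "eta3 $ n = (- 1) ^ (3 * m + 1) * int (2 * (3 * m + 1) + 1)"
      using j jacobi_tri[of j] by (simp_all only: eta3_def tri_3_1)
    have "(- 1 :: int) ^ (3 * m) = (- 1) ^ m" by (simp add: power_mult)
    moreover have "eta3 $ tri m = (- 1) ^ m * int (2 * m + 1)" by (simp only: eta3_def jacobi_tri)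
    moreover have "n mod 9 = 1" "n div 9 = tri m" using n by simp_all
    ultimately show ?thesis unfolding R res_part_nth using True n' by (simp add: algebra_simps)
  next
    case False
    have "eta3 $ (n div 9) = 0" if "n mod 9 = 1"
    proof -
      have "n mod 3 = 1" using that by presburger
      moreover have "n = 9 * (n div 9) + 1" using that by presburger
      ultimately have "n div 9 \<notin> range tri" using False by (metis rangeE rangeI tri_3_1)
      then show ?thesis unfolding eta3_def by (rule jacobi_non_tri)
    qed
    then show ?thesis using False jacobi_non_tri[of n] unfolding R res_part_nth by (auto simp: eta3_def)
  qed
qed

lemma eta3_part_2: "res_part 2 eta3 = 0"
proof (rule fps_ext)
  fix n
  have "n \<notin> range tri" if "n mod 3 = 2"
  proof
    assume "n \<in> range tri"
    then obtain j where j: "n = tri j" by auto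
    have "\<exists>m. j = 3 * m \<or> j = 3 * m + 1 \<or> j = 3 * m + 2" by presburger
    then show False using tri_mod_3 that j by (metis numeral_eq_one_iff semiring_norm(85) zero_neq_numeral)
  qed
  then show "res_part 2 eta3 $ n = (0 :: int fps) $ n" using jacobi_non_tri[of n] by (auto simp: res_part_nth eta3_def)
qed

lemma eta3_dissection: "eta3 = dil 3 (trisect eta3) - 3 * fps_X * dil 9 eta3"
proof -
  have "eta3 = res_part 0 eta3 + res_part 1 eta3 + res_part 2 eta3" by (rule res_part_decomp)
  also have "\<dots> = dil 3 (trisect eta3) - 3 * fps_X * dil 9 eta3"
    unfolding eta3_part_1 eta3_part_2 res_part_0_eq by simp
  finally show ?thesis .
qed

text \<open>Two evaluations of the norm of E(q)^3: from the dissection, where the absent residue 2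
  removes the mixed term, and as the cube of the norm of E(q).\<close>

lemma eta3_norm:
  "(dil 3 (trisect eta3) ^ 3 - 27 * fps_X ^ 3 * dil 9 eta3 ^ 3) * dil 9 eta3 = dil 3 eta3 ^ 4"
proof -
  have "norm3 eta3 = dil 3 (trisect eta3) ^ 3 - 27 * fps_X ^ 3 * dil 9 eta3 ^ 3"
    unfolding norm3_def eta3_part_1 eta3_part_2 res_part_0_eq by (simp add: power_mult_distrib)
  moreover have "norm3 eta3 * dil 9 eta3 = (norm3 (eulerE 1) * eulerE 9) ^ 3"
    unfolding power_mult_distrib norm3_power[symmetric] eta3_def[symmetric]
    by (simp only: dil_eta3 zero_less_numeral)
  moreover have "(eulerE 3 ^ 4) ^ 3 = dil 3 eta3 ^ 4"
    by (simp add: dil_eta3 power_mult[symmetric])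
  ultimately show ?thesis by (simp only: norm3_eulerE)
qed

section \<open>Trisection of powers of the Hauptmodul\<close>

definition ieta3 :: "int fps" where
  "ieta3 = fps_right_inverse eta3 1"

lemma eta3_ieta3: "eta3 * ieta3 = 1"
  unfolding ieta3_def eta3_def by (rule fps_right_inverse) (simp add: fps_nth_power_0)

lemma dil_eta3_ieta3: "r > 0 \<Longrightarrow> dil r eta3 * dil r ieta3 = 1"
  using arg_cong[OF eta3_ieta3, of "dil r"] by simp

text \<open>The series t of the introduction, a Hauptmodul of \<Gamma>_0(3);
  \<open>dil 3 hauptmodul\<close> is \<tau> and \<open>cubic_root\<close> is y.\<close>

definition hauptmodul :: "int fps" where
  "hauptmodul = fps_X * dil 3 eta3 ^ 4 * ieta3 ^ 4"

definition cubic_root :: "int fps" where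
  "cubic_root = fps_X * dil 9 eta3 * ieta3"

lemma dil_hauptmodul: "dil 3 hauptmodul = fps_X ^ 3 * dil 9 eta3 ^ 4 * dil 3 ieta3 ^ 4"
  by (simp add: hauptmodul_def dil_dil)

text \<open>Rationalising the denominator: 1 / (A - 3B) = (A^2 + 3AB + 9B^2) / (A^3 - 27B^3), where
  \<open>eta3_norm\<close> evaluates the denominator, a series in q^3.\<close>

lemma ieta3_expand:
  "ieta3 = (dil 3 (trisect eta3) ^ 2 + 3 * dil 3 (trisect eta3) * (fps_X * dil 9 eta3) + 9 * (fps_X * dil 9 eta3) ^ 2)
     * dil 3 ieta3 ^ 4 * dil 9 eta3"
    (is "_ = (?A ^ 2 + 3 * ?A * ?B + 9 * ?B ^ 2) * ?W ^ 4 * ?V")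
proof -
  have "eta3 * ((?A ^ 2 + 3 * ?A * ?B + 9 * ?B ^ 2) * ?W ^ 4 * ?V) =
     (?A - 3 * ?B) * (?A ^ 2 + 3 * ?A * ?B + 9 * ?B ^ 2) * ?W ^ 4 * ?V"
    using eta3_dissection by (simp only: mult.assoc)
  also have "\<dots> = (?A ^ 3 - 27 * ?B ^ 3) * ?V * ?W ^ 4"
    by (simp add: power3_eq_cube power2_eq_square algebra_simps)
  also have "\<dots> = (dil 3 eta3 * ?W) ^ 4"
    unfolding power_mult_distrib mult.assoc[symmetric] eta3_norm ..
  also have "\<dots> = 1" by (simp add: dil_eta3_ieta3)
  finally have "eta3 * ((?A ^ 2 + 3 * ?A * ?B + 9 * ?B ^ 2) * ?W ^ 4 * ?V) = eta3 * ieta3"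
    by (simp add: eta3_ieta3)
  moreover have "eta3 \<noteq> 0" using eta3_ieta3 by auto
  ultimately show ?thesis by simp
qed

text \<open>With B = y E(q)^3 and A = E(q)^3 + 3B, the norm A^3 - 27B^3 is E(q)^9 (1 + 9y + 27y^2);
  \<open>eta3_norm\<close> gives its product with \<tau> as B^3.\<close>

lemma cubic_root_cubed:
  "cubic_root ^ 3 = dil 3 hauptmodul * (1 + 9 * cubic_root + 27 * cubic_root ^ 2)"
proof -
  define B where "B = fps_X * dil 9 eta3"
  have y: "cubic_root * eta3 = B"
    using eta3_ieta3 by (simp add: cubic_root_def B_def ac_simps)
  have A: "dil 3 (trisect eta3) = eta3 + 3 * B"
    using eta3_dissection unfolding B_def by (metis diff_add_cancel mult.assoc)
  have "dil 3 hauptmodul * ((dil 3 (trisect eta3)) ^ 3 - 27 * B ^ 3) =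
      fps_X ^ 3 * dil 9 eta3 ^ 3 * dil 3 ieta3 ^ 4 * ((dil 3 (trisect eta3) ^ 3 - 27 * fps_X ^ 3 * dil 9 eta3 ^ 3) * dil 9 eta3)"
    unfolding dil_hauptmodul B_def by (simp add: power_mult_distrib eval_nat_numeral algebra_simps)
  also have "\<dots> = B ^ 3 * (dil 3 eta3 * dil 3 ieta3) ^ 4"
    unfolding eta3_norm B_def power_mult_distrib by (simp only: ac_simps)
  finally have main: "dil 3 hauptmodul * ((dil 3 (trisect eta3)) ^ 3 - 27 * B ^ 3) = B ^ 3"
    by (simp add: dil_eta3_ieta3)
  have "(dil 3 hauptmodul * (1 + 9 * cubic_root + 27 * cubic_root ^ 2)) * eta3 ^ 3
      = dil 3 hauptmodul * (eta3 ^ 3 + 9 * (cubic_root * eta3) * eta3 ^ 2 + 27 * (cubic_root * eta3) ^ 2 * eta3)"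
    by (simp add: power3_eq_cube power2_eq_square algebra_simps)
  also have "\<dots> = dil 3 hauptmodul * ((dil 3 (trisect eta3)) ^ 3 - 27 * B ^ 3)"
    unfolding y A by (simp add: power3_eq_cube power2_eq_square algebra_simps)
  also have "\<dots> = B ^ 3" by (rule main)
  also have "\<dots> = cubic_root ^ 3 * eta3 ^ 3"
    unfolding y[symmetric] power_mult_distrib ..
  finally have "cubic_root ^ 3 * eta3 ^ 3 =
      (dil 3 hauptmodul * (1 + 9 * cubic_root + 27 * cubic_root ^ 2)) * eta3 ^ 3" ..
  moreover have "eta3 ^ 3 \<noteq> 0" using eta3_ieta3 by auto
  ultimately show ?thesis by (metis mult_right_cancel)
qed

lemma cubic_root_pow4: "cubic_root ^ 4 = dil 3 hauptmodul * hauptmodul"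
proof -
  have "dil 3 hauptmodul * hauptmodul =
      (fps_X ^ 3 * fps_X) * dil 9 eta3 ^ 4 * ieta3 ^ 4 * (dil 3 eta3 * dil 3 ieta3) ^ 4"
    unfolding dil_hauptmodul unfolding hauptmodul_def power_mult_distrib by (simp only: ac_simps)
  also have "fps_X ^ 3 * fps_X = (fps_X ^ 4 :: int fps)" by (simp add: eval_nat_numeral)
  finally show ?thesis
    by (simp add: dil_eta3_ieta3 cubic_root_def power_mult_distrib)
qed

lemma res_part_dil_3: "res_part i (dil 3 g) = (if i = 0 then dil 3 g else 0)"
  by (auto simp: fps_eq_iff res_part_nth dil_nth mod_eq_0_iff_dvd)

lemma trisect_dil [simp]: "trisect (dil 3 g) = g"
  by (simp add: fps_eq_iff trisect_nth dil_nth)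

text \<open>Trisection is linear over the series in q^3. This is what turns identities for y into
  recurrences.\<close>

lemma trisect_mult_dil: "trisect (f * dil 3 g) = trisect f * g"
proof -
  have "dil 3 (trisect (f * dil 3 g)) = dil 3 (trisect f * g)"
    by (simp flip: res_part_0_eq add: res_part_mult res_part_dil_3)
  then show ?thesis using trisect_dil by metis
qed

lemma trisect_dil_mult: "trisect (dil 3 g * f) = g * trisect f"
  using trisect_mult_dil[of f g] by (simp only: mult.commute)

lemma trisect_X_mult_dil [simp]: "trisect (fps_X * dil 3 g) = 0" "trisect (fps_X ^ 2 * dil 3 g) = 0"
proof -
  have X: "trisect fps_X = 0" "trisect (fps_X ^ 2) = 0"
    by (auto simp: fps_eq_iff trisect_nth fps_X_nth) presburger+
  show "trisect (fps_X * dil 3 g) = 0" "trisect (fps_X ^ 2 * dil 3 g) = 0"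
    unfolding trisect_mult_dil X by simp_all
qed

text \<open>Expanded by \<open>ieta3_expand\<close>, y has three terms, with q, q^2 and q^3 times
  series in q^3. Only the last survives, and it is 9 \<tau>.\<close>

lemma trisect_cubic_root_1: "trisect cubic_root = 9 * hauptmodul"
proof -
  define A V W where "A = dil 3 (trisect eta3)" and "V = dil 9 eta3" and "W = dil 3 ieta3"
  define a v w where "a = trisect eta3" and "v = dil 3 eta3" and "w = ieta3"
  have *: "A = dil 3 a" "V = dil 3 v" "W = dil 3 w"
    by (simp_all add: A_def V_def W_def a_def v_def w_def dil_dil)
  have t: "dil 3 hauptmodul = fps_X ^ 3 * V ^ 4 * W ^ 4" by (simp add: V_def W_def dil_hauptmodul)
  have "cubic_root = fps_X * V * ((A ^ 2 + 3 * A * (fps_X * V) + 9 * (fps_X * V) ^ 2) * W ^ 4 * V)"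
    unfolding cubic_root_def A_def V_def W_def by (subst ieta3_expand) (rule refl)
  also have "\<dots> = fps_X * (A ^ 2 * V ^ 2 * W ^ 4) + fps_X ^ 2 * (3 * A * V ^ 3 * W ^ 4) + 9 * dil 3 hauptmodul"
    unfolding t by (simp add: eval_nat_numeral algebra_simps)
  also have "\<dots> = fps_X * dil 3 (a ^ 2 * v ^ 2 * w ^ 4) + fps_X ^ 2 * dil 3 (3 * a * v ^ 3 * w ^ 4)
      + dil 3 (9 * hauptmodul)"
    unfolding * by simp
  finally have "trisect cubic_root = trisect (fps_X * dil 3 (a ^ 2 * v ^ 2 * w ^ 4))
      + trisect (fps_X ^ 2 * dil 3 (3 * a * v ^ 3 * w ^ 4)) + trisect (dil 3 (9 * hauptmodul))"
    by (metis trisect_add)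
  then show ?thesis by (simp only: trisect_dil trisect_X_mult_dil add_0_left)
qed

text \<open>In B^2 (A^2 + 3AB + 9B^2)^2 the surviving terms are 6 A^3 B^3 and 81 B^6. Replacing A^3
  by the norm relation gives 6 and 6 * 27 + 81 = 243.\<close>

lemma trisect_cubic_root_2: "trisect (cubic_root ^ 2) = 6 * hauptmodul + 243 * hauptmodul ^ 2"
proof -
  define A V W where "A = dil 3 (trisect eta3)" and "V = dil 9 eta3" and "W = dil 3 ieta3"
  define a v w where "a = trisect eta3" and "v = dil 3 eta3" and "w = ieta3"
  have *: "A = dil 3 a" "V = dil 3 v" "W = dil 3 w"
    by (simp_all add: A_def V_def W_def a_def v_def w_def dil_dil)
  have norm: "A ^ 3 * V = dil 3 eta3 ^ 4 + 27 * fps_X ^ 3 * V ^ 4"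
    using eta3_norm unfolding A_def[symmetric] V_def[symmetric] by (simp add: eval_nat_numeral algebra_simps)
  have UW: "dil 3 eta3 * W = 1" by (simp add: W_def dil_eta3_ieta3)
  have t: "dil 3 hauptmodul = fps_X ^ 3 * V ^ 4 * W ^ 4" by (simp add: V_def W_def dil_hauptmodul)
  have "fps_X ^ 3 * V ^ 3 * W ^ 8 * (A ^ 3 * V) = fps_X ^ 3 * V ^ 3 * W ^ 4 * ((dil 3 eta3 * W) ^ 4) + 27 * fps_X ^ 6 * V ^ 7 * W ^ 8"
    unfolding norm by (simp add: power_mult_distrib algebra_simps flip: power_add)
  then have cross: "A ^ 3 * fps_X ^ 3 * V ^ 4 * W ^ 8 = fps_X ^ 3 * V ^ 3 * W ^ 4 + 27 * fps_X ^ 6 * V ^ 7 * W ^ 8"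
    unfolding UW by (simp add: eval_nat_numeral algebra_simps)
  have "cubic_root ^ 2 = (fps_X * V * ((A ^ 2 + 3 * A * (fps_X * V) + 9 * (fps_X * V) ^ 2) * W ^ 4 * V)) ^ 2"
    unfolding cubic_root_def A_def V_def W_def by (subst ieta3_expand) (rule refl)
  also have "\<dots> = fps_X ^ 2 * (A ^ 4 * V ^ 4 * W ^ 8) + 6 * (A ^ 3 * fps_X ^ 3 * V ^ 4 * W ^ 8) * V
     + fps_X * (27 * fps_X ^ 3 * A ^ 2 * V ^ 6 * W ^ 8) + fps_X ^ 2 * (54 * fps_X ^ 3 * A * V ^ 7 * W ^ 8)
     + 81 * fps_X ^ 6 * V ^ 8 * W ^ 8"
    by (simp add: eval_nat_numeral algebra_simps)
  also have "\<dots> = fps_X ^ 2 * (A ^ 4 * V ^ 4 * W ^ 8)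
     + fps_X * (27 * fps_X ^ 3 * A ^ 2 * V ^ 6 * W ^ 8) + fps_X ^ 2 * (54 * fps_X ^ 3 * A * V ^ 7 * W ^ 8)
     + (6 * dil 3 hauptmodul + 243 * dil 3 hauptmodul ^ 2)"
    unfolding cross t by (simp add: eval_nat_numeral algebra_simps)
  also have "\<dots> = fps_X ^ 2 * dil 3 (a ^ 4 * v ^ 4 * w ^ 8)
     + fps_X * dil 3 (27 * fps_X * a ^ 2 * v ^ 6 * w ^ 8) + fps_X ^ 2 * dil 3 (54 * fps_X * a * v ^ 7 * w ^ 8)
     + dil 3 (6 * hauptmodul + 243 * hauptmodul ^ 2)"
    unfolding * by simp
  finally show ?thesis by (simp only: trisect_add trisect_dil trisect_X_mult_dil add_0_left)
qed

section \<open>Integer combinations of 3-adically weighted powers of t\<close>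

interpretation zfps: Modules.module "\<lambda>(k :: int) (f :: int fps). of_int k * f"
  by unfold_locales (simp_all add: algebra_simps)

lemma dil_of_int [simp]: "dil r (of_int k) = of_int k"
  unfolding dil_def fps_of_int[symmetric] by simp

lemma trisect_of_int_mult: "trisect (of_int k * f) = of_int k * trisect f"
  using trisect_dil_mult[of "of_int k" f] by simp

lemma trisect_0 [simp]: "trisect 0 = 0"
  by (simp add: fps_eq_iff trisect_nth)

text \<open>The weights come from \<open>Y = 3 y\<close> and \<open>T = 27 \<tau>\<close>, which turn the cubic equation
  \<open>y^3 = \<tau> (1 + 9 y + 27 y^2)\<close> into \<open>Y^3 = T (1 + 3 Y + 3 Y^2)\<close>. The condition on \<open>j\<close> makes the
  subtraction exact.\<close>

definition powers_gen :: "nat \<Rightarrow> int fps set" where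
  "powers_gen k = {3 ^ (3 * j - k) * hauptmodul ^ j |j. k \<le> 3 * j}"

text \<open>Beyond the common 3^c, the power t^(j+1) carries 9^j. Both survive trisection, and
  modulo 9 only the first power of t remains.\<close>

definition tail_gen :: "nat \<Rightarrow> int fps set" where
  "tail_gen c = {3 ^ (c + 2 * j) * hauptmodul ^ (j + 1) |j. True}"

lemma span_mult:
  assumes "x \<in> zfps.span S" "\<And>s. s \<in> S \<Longrightarrow> f * s \<in> zfps.span T"
  shows "f * x \<in> zfps.span T"
  using assms(1)
proof (induction rule: zfps.span_induct_alt)
  case base
  then show ?case by (simp add: zfps.span_zero)
next
  case (step k s y)
  have "f * (of_int k * s + y) = of_int k * (f * s) + f * y" by (simp add: algebra_simps)
  then show ?case using step assms(2) by (simp add: zfps.span_add zfps.span_scale)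
qed

text \<open>The first inequality says that 3^e pays for the change of weight, the second that the
  new exponents of t stay admissible.\<close>

lemma span_powers_shift:
  assumes "x \<in> zfps.span (powers_gen i)" "3 * r + i \<le> e + k" "k \<le> i + 3 * r"
  shows "3 ^ e * hauptmodul ^ r * x \<in> zfps.span (powers_gen k)"
  using assms(1)
proof (rule span_mult)
  fix s assume "s \<in> powers_gen i"
  then obtain j where j: "i \<le> 3 * j" and s: "s = 3 ^ (3 * j - i) * hauptmodul ^ j"
    by (auto simp: powers_gen_def)
  define m where "m = e + (3 * j - i) - (3 * (j + r) - k)"
  have m: "e + (3 * j - i) = m + (3 * (j + r) - k)" using assms(2,3) j by (simp add: m_def)
  have "3 ^ e * hauptmodul ^ r * s = 3 ^ (e + (3 * j - i)) * hauptmodul ^ (j + r)"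
    by (simp add: s power_add ac_simps)
  also have "\<dots> = of_int (3 ^ m) * (3 ^ (3 * (j + r) - k) * hauptmodul ^ (j + r))"
    unfolding m by (simp add: power_add ac_simps)
  also have "\<dots> \<in> zfps.span (powers_gen k)"
    using j assms(3) by (intro zfps.span_scale zfps.span_base) (auto simp: powers_gen_def intro!: exI[of _ "j + r"])
  finally show "3 ^ e * hauptmodul ^ r * s \<in> zfps.span (powers_gen k)" .
qed

text \<open>Trisecting y^m times the cubic equation gives a recurrence with coefficients t, 9t, 27t,
  while the weights ask only for t, 3t, 9t. The exponents 0, 1, 2 start the induction.\<close>

lemma trisect_cubic_root_power: "trisect (cubic_root ^ k) \<in> zfps.span (powers_gen k)"
proof (induction k rule: less_induct)
  case (less k)
  have gen: "3 ^ (3 * j - k) * hauptmodul ^ j \<in> zfps.span (powers_gen k)" if "k \<le> 3 * j" for j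
    using that by (intro zfps.span_base) (auto simp: powers_gen_def)
  consider "k = 0" | "k = 1" | "k = 2" | m where "k = m + 3"
    by (metis One_nat_def Suc_1 add.commute le_Suc_ex less_2_cases not_less numeral_3_eq_3 less_Suc_eq)
  then show ?case
  proof cases
    case 1
    have "trisect (1 :: int fps) = 1" using trisect_dil[of 1] by simp
    then show ?thesis using gen[of 0] 1 by simp
  next
    case 2
    then show ?thesis using gen[of 1] by (simp add: trisect_cubic_root_1)
  next
    case 3
    have "of_int 2 * (3 * hauptmodul) + of_int 3 * (81 * hauptmodul ^ 2) \<in> zfps.span (powers_gen k)"
      using gen[of 1] gen[of 2] 3 by (intro zfps.span_add zfps.span_scale) simp_all
    then show ?thesis by (simp add: 3 trisect_cubic_root_2)
  next
    case (4 m)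
    have rec: "cubic_root ^ k = dil 3 hauptmodul *
        (cubic_root ^ m + 9 * cubic_root ^ (m + 1) + 27 * cubic_root ^ (m + 2))"
      unfolding 4 power_add cubic_root_cubed by (simp add: power2_eq_square algebra_simps)
    have lin: "trisect (9 * f) = 9 * trisect f" "trisect (27 * f) = 27 * trisect f" for f
      using trisect_of_int_mult[of 9 f] trisect_of_int_mult[of 27 f] by simp_all
    have "trisect (cubic_root ^ k) = 3 ^ 0 * hauptmodul ^ 1 * trisect (cubic_root ^ m)
       + 3 ^ 2 * hauptmodul ^ 1 * trisect (cubic_root ^ (m + 1)) + 3 ^ 3 * hauptmodul ^ 1 * trisect (cubic_root ^ (m + 2))"
      unfolding rec trisect_dil_mult trisect_add lin by (simp add: algebra_simps)
    moreover have "3 ^ 0 * hauptmodul ^ 1 * trisect (cubic_root ^ m) \<in> zfps.span (powers_gen k)"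
      by (rule span_powers_shift[OF less]) (simp_all add: 4)
    moreover have "3 ^ 2 * hauptmodul ^ 1 * trisect (cubic_root ^ (m + 1)) \<in> zfps.span (powers_gen k)"
      by (rule span_powers_shift[OF less]) (simp_all add: 4)
    moreover have "3 ^ 3 * hauptmodul ^ 1 * trisect (cubic_root ^ (m + 2)) \<in> zfps.span (powers_gen k)"
      by (rule span_powers_shift[OF less]) (simp_all add: 4)
    ultimately show ?thesis by (simp only: zfps.span_add)
  qed
qed

lemma hauptmodul_nonzero: "hauptmodul \<noteq> 0"
proof -
  have "hauptmodul $ 1 = 1"
    using eta3_ieta3 by (simp add: hauptmodul_def mult.assoc eta3_def ieta3_def fps_nth_power_0 dil_nth)
  then show ?thesis by (metis fps_zero_nth zero_neq_one)
qed

text \<open>Every generator on the left is divisible by t^i, because 3j \<ge> 4i forces j \<ge> i,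
  and division by t^i lowers the weight index by 3i.\<close>

lemma span_powers_strip:
  assumes "hauptmodul ^ i * f \<in> zfps.span (powers_gen (4 * i + d))"
  shows "f \<in> zfps.span (powers_gen (i + d))"
proof -
  have "\<exists>x\<in>zfps.span (powers_gen (i + d)). z = hauptmodul ^ i * x"
    if "z \<in> zfps.span (powers_gen (4 * i + d))" for z
    using that
  proof (induction rule: zfps.span_induct_alt)
    case base
    then show ?case using zfps.span_zero by force
  next
    case (step k s y)
    then obtain j where j: "4 * i + d \<le> 3 * j" and s: "s = 3 ^ (3 * j - (4 * i + d)) * hauptmodul ^ j"
      by (auto simp: powers_gen_def)
    from step obtain x where x: "x \<in> zfps.span (powers_gen (i + d))" "y = hauptmodul ^ i * x" by blast
    define m where "m = j - i"
    have m: "j = i + m" "i + d \<le> 3 * m" "3 * j - (4 * i + d) = 3 * m - (i + d)"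
      using j by (simp_all add: m_def)
    define g where "g = 3 ^ (3 * m - (i + d)) * hauptmodul ^ m"
    have "g \<in> powers_gen (i + d)" using m by (auto simp: powers_gen_def g_def)
    then have "of_int k * g + x \<in> zfps.span (powers_gen (i + d))"
      by (intro zfps.span_add zfps.span_scale x(1)) (rule zfps.span_base)
    moreover have "of_int k * s + y = hauptmodul ^ i * (of_int k * g + x)"
      unfolding s x m(3) g_def m(1) by (simp add: power_add algebra_simps)
    ultimately show ?case by blast
  qed
  with assms hauptmodul_nonzero show ?thesis by fastforce
qed

text \<open>From y^(4i) = \<tau>^i t^i, trisection of y^(4i) equals t^i times trisection of
  t^i.\<close>

lemma trisect_hauptmodul_power: "trisect (hauptmodul ^ i) \<in> zfps.span (powers_gen (i + 0))"
proof (rule span_powers_strip)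
  have "cubic_root ^ (4 * i) = dil 3 (hauptmodul ^ i) * hauptmodul ^ i"
    by (simp add: power_mult cubic_root_pow4 power_mult_distrib)
  then have "hauptmodul ^ i * trisect (hauptmodul ^ i) = trisect (cubic_root ^ (4 * i))"
    by (simp only: trisect_dil_mult)
  then show "hauptmodul ^ i * trisect (hauptmodul ^ i) \<in> zfps.span (powers_gen (4 * i + 0))"
    using trisect_cubic_root_power[of "4 * i"] by simp
qed

text \<open>The same with y^(4i+1): the factor E(q^9)^3 of y leaves the trisection as
  E(q^3)^3.\<close>

lemma trisect_X_hauptmodul_power:
  "dil 3 eta3 * trisect (fps_X * ieta3 * hauptmodul ^ i) \<in> zfps.span (powers_gen (i + 1))"
proof (rule span_powers_strip)
  have "cubic_root ^ (4 * i + 1) = (cubic_root ^ 4) ^ i * cubic_root"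
    by (simp add: power_mult)
  also have "\<dots> = dil 3 (hauptmodul ^ i * dil 3 eta3) * (fps_X * ieta3 * hauptmodul ^ i)"
    unfolding cubic_root_pow4 unfolding cubic_root_def
    by (simp add: power_mult_distrib dil_dil ac_simps)
  finally have "hauptmodul ^ i * (dil 3 eta3 * trisect (fps_X * ieta3 * hauptmodul ^ i)) = trisect (cubic_root ^ (4 * i + 1))"
    by (simp only: trisect_dil_mult mult.assoc)
  then show "hauptmodul ^ i * (dil 3 eta3 * trisect (fps_X * ieta3 * hauptmodul ^ i)) \<in> zfps.span (powers_gen (4 * i + 1))"
    using trisect_cubic_root_power[of "4 * i + 1"] by simp
qed

text \<open>Used with d = 0 for plain trisection and d = 1 in the presence of q / E(q)^3; the gain
  is 3^(2-d).\<close>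

lemma span_powers_tail:
  assumes "x \<in> zfps.span (powers_gen (j + 1 + d))" "c' + d = c + 2"
  shows "3 ^ (c + 2 * j) * x \<in> zfps.span (tail_gen c')"
  using assms(1)
proof (rule span_mult)
  fix s assume "s \<in> powers_gen (j + 1 + d)"
  then obtain m where m: "j + 1 + d \<le> 3 * m" and s: "s = 3 ^ (3 * m - (j + 1 + d)) * hauptmodul ^ m"
    by (auto simp: powers_gen_def)
  then obtain n where n: "m = n + 1" by (cases m) auto
  obtain e where e: "3 * m = j + 1 + d + e" using m by (metis le_Suc_ex)
  \<comment> \<open>The surplus power of 3 beyond what \<open>tail_gen c'\<close> demands.\<close>
  define r where "r = j + n"
  have r: "c + 2 * j + e = r + (c' + 2 * n)"
    using assms(2) e unfolding r_def n by simp
  have "3 ^ (c + 2 * j) * s = 3 ^ (c + 2 * j + e) * hauptmodul ^ m"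
    unfolding s e by (simp add: power_add mult.assoc)
  also have "\<dots> = of_int (3 ^ r) * (3 ^ (c' + 2 * n) * hauptmodul ^ (n + 1))"
    unfolding r n by (simp add: power_add ac_simps)
  also have "\<dots> \<in> zfps.span (tail_gen c')"
    by (intro zfps.span_scale zfps.span_base) (auto simp: tail_gen_def)
  finally show "3 ^ (c + 2 * j) * s \<in> zfps.span (tail_gen c')" .
qed

lemma trisect_tail:
  assumes "x \<in> zfps.span (tail_gen c)"
  shows "trisect x \<in> zfps.span (tail_gen (c + 2))"
  using assms
proof (induction rule: zfps.span_induct_alt)
  case base
  then show ?case by (simp add: zfps.span_zero)
next
  case (step k s y)
  then obtain j where s: "s = 3 ^ (c + 2 * j) * hauptmodul ^ (j + 1)" by (auto simp: tail_gen_def)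
  have "trisect s = 3 ^ (c + 2 * j) * trisect (hauptmodul ^ (j + 1))"
    using trisect_dil_mult[of "3 ^ (c + 2 * j)"] unfolding s by simp
  also have "\<dots> \<in> zfps.span (tail_gen (c + 2))"
    by (rule span_powers_tail[OF trisect_hauptmodul_power]) simp
  finally show ?case
    using step.IH by (simp only: trisect_add trisect_of_int_mult zfps.span_add zfps.span_scale)
qed

lemma trisect_X_tail:
  assumes "x \<in> zfps.span (tail_gen c)"
  shows "dil 3 eta3 * trisect (fps_X * ieta3 * x) \<in> zfps.span (tail_gen (c + 1))"
  using assms
proof (induction rule: zfps.span_induct_alt)
  case base
  then show ?case by (simp add: zfps.span_zero)
next
  case (step k s y)
  then obtain j where s: "s = 3 ^ (c + 2 * j) * hauptmodul ^ (j + 1)" by (auto simp: tail_gen_def)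
  have e: "fps_X * ieta3 * s = dil 3 (3 ^ (c + 2 * j)) * (fps_X * ieta3 * hauptmodul ^ (j + 1))"
    by (simp add: s ac_simps)
  have "dil 3 eta3 * trisect (fps_X * ieta3 * s) =
      3 ^ (c + 2 * j) * (dil 3 eta3 * trisect (fps_X * ieta3 * hauptmodul ^ (j + 1)))"
    unfolding e trisect_dil_mult by (rule mult.left_commute)
  also have "\<dots> \<in> zfps.span (tail_gen (c + 1))"
    by (rule span_powers_tail[OF trisect_X_hauptmodul_power]) simp
  finally have "of_int k * (dil 3 eta3 * trisect (fps_X * ieta3 * s)) + dil 3 eta3 * trisect (fps_X * ieta3 * y)
      \<in> zfps.span (tail_gen (c + 1))"
    using step.IH by (intro zfps.span_add zfps.span_scale)
  moreover have "fps_X * ieta3 * (of_int k * s + y) = of_int k * (fps_X * ieta3 * s) + fps_X * ieta3 * y"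
    by (simp add: algebra_simps)
  ultimately show ?case
    by (simp only: trisect_add trisect_of_int_mult distrib_left mult.left_commute[of "dil 3 eta3" "of_int k"])
qed

section \<open>Generating functions along arithmetic progressions\<close>

lemma trisect_X_mult: "trisect (fps_X * f) = fps_X * Abs_fps (\<lambda>n. f $ (3 * n + 2))"
proof (rule fps_ext)
  fix n show "trisect (fps_X * f) $ n = (fps_X * Abs_fps (\<lambda>n. f $ (3 * n + 2))) $ n"
    by (cases n) (simp_all add: trisect_nth)
qed

lemma trisect_X_X_mult: "trisect (fps_X * (fps_X * f)) = fps_X * Abs_fps (\<lambda>n. f $ (3 * n + 1))"
proof (rule fps_ext)
  fix n show "trisect (fps_X * (fps_X * f)) $ n = (fps_X * Abs_fps (\<lambda>n. f $ (3 * n + 1))) $ n"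
    by (cases n) (simp_all add: trisect_nth)
qed

text \<open>The division is exact for the arguments \<open>l = 3 ^ (2 * i + 1)\<close> used below.\<close>

definition offset :: "nat \<Rightarrow> nat" where
  "offset l = (5 * l + 1) div 8"

lemma offset_rec: "offset (3 ^ (2 * i + 3)) = 5 * 3 ^ (2 * i + 1) + offset (3 ^ (2 * i + 1))"
proof -
  define x :: nat where "x = 3 ^ (2 * i + 1)"
  have "3 ^ (2 * i + 3) = 9 * x" by (simp add: x_def power_add)
  moreover have "5 * (9 * x) + 1 = (5 * x + 1) + 8 * (5 * x)" by simp
  ultimately show ?thesis unfolding offset_def x_def[symmetric] by simp
qed

text \<open>Each step trisects twice, without and then with q / E(q)^3, and so gains 9 * 3 = 27. The
  residues 2 and then 1 combine to 3 (3n + 1) + 2 = 9n + 5, in agreement with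
  \<open>offset_rec\<close>.\<close>

lemma ieta3_section:
  "dil 3 eta3 * (fps_X * Abs_fps (\<lambda>n. ieta3 $ (3 ^ (2 * i + 1) * n + offset (3 ^ (2 * i + 1)))))
     \<in> zfps.span (tail_gen (3 * i + 2))"
proof (induction i)
  case 0
  have e: "3 ^ (2 * 0 + 1) = (3 :: nat)" "3 * 0 + 2 = (2 :: nat)" "offset 3 = 2"
    by (simp_all add: offset_def)
  have first: "dil 3 eta3 * trisect (fps_X * ieta3) = 9 * hauptmodul"
  proof -
    have "cubic_root = dil 3 (dil 3 eta3) * (fps_X * ieta3)"
      by (simp add: cubic_root_def dil_dil ac_simps)
    from arg_cong[OF this, of trisect] show ?thesis by (simp only: trisect_dil_mult trisect_cubic_root_1)
  qed
  have "9 * hauptmodul \<in> zfps.span (tail_gen 2)"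
    by (rule zfps.span_base) (auto simp: tail_gen_def intro!: exI[of _ 0])
  then show ?case unfolding e trisect_X_mult[symmetric] first .
next
  case (Suc i)
  define C where "C = Abs_fps (\<lambda>n. ieta3 $ (3 ^ (2 * i + 1) * n + offset (3 ^ (2 * i + 1))))"
  define \<phi> where "\<phi> = dil 3 eta3 * (fps_X * C)"
  have \<phi>: "\<phi> \<in> zfps.span (tail_gen (3 * i + 2))" using Suc.IH by (simp only: \<phi>_def C_def)
  define D where "D = Abs_fps (\<lambda>n. C $ (3 * n + 2))"
  have "trisect \<phi> = eta3 * (fps_X * D)"
    unfolding \<phi>_def trisect_dil_mult trisect_X_mult D_def ..
  then have "fps_X * ieta3 * trisect \<phi> = fps_X * (fps_X * D) * (eta3 * ieta3)"
    by (simp only: ac_simps)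
  then have S: "trisect (fps_X * ieta3 * trisect \<phi>) = fps_X * Abs_fps (\<lambda>n. D $ (3 * n + 1))"
    by (simp only: eta3_ieta3 mult_1_right trisect_X_X_mult)
  have D: "D $ (3 * n + 1) = ieta3 $ (3 ^ (2 * Suc i + 1) * n + offset (3 ^ (2 * Suc i + 1)))" for n
  proof -
    have "3 ^ (2 * i + 1) * (3 * (3 * n + 1) + 2) + offset (3 ^ (2 * i + 1)) = 3 ^ (2 * i + 3) * n + offset (3 ^ (2 * i + 3))"
      unfolding offset_rec by (simp add: algebra_simps eval_nat_numeral)
    then show ?thesis by (simp add: D_def C_def eval_nat_numeral)
  qed
  have "dil 3 eta3 * trisect (fps_X * ieta3 * trisect \<phi>) \<in> zfps.span (tail_gen (3 * i + 2 + 2 + 1))"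
    by (intro trisect_X_tail trisect_tail \<phi>)
  moreover have "3 * i + 2 + 2 + 1 = 3 * Suc i + 2" by simp
  ultimately show ?case unfolding S D by (simp only:)
qed

text \<open>Only multiples of l contribute from the second factor, and r < l keeps them at most l
  n.\<close>

lemma mult_dil_section:
  assumes "r < l"
  shows "Abs_fps (\<lambda>n. (f * dil l g) $ (l * n + r)) = Abs_fps (\<lambda>n. f $ (l * n + r)) * g"
proof (rule fps_ext)
  fix n
  have l: "l > 0" using assms by simp
  have "(f * dil l g) $ (l * n + r) = (\<Sum>i=0..l * n + r. dil l g $ i * f $ (l * n + r - i))"
    unfolding mult.commute[of f] fps_mult_nth ..
  also have "\<dots> = (\<Sum>i\<in>(*) l ` {0..n}. dil l g $ i * f $ (l * n + r - i))"
  proof (rule sum.mono_neutral_right)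
    show "(*) l ` {0..n} \<subseteq> {0..l * n + r}" by (auto intro!: trans_le_add1 mult_le_mono2)
    show "\<forall>i\<in>{0..l * n + r} - (*) l ` {0..n}. dil l g $ i * f $ (l * n + r - i) = 0"
    proof
      fix i assume i: "i \<in> {0..l * n + r} - (*) l ` {0..n}"
      have "\<not> l dvd i"
      proof
        assume "l dvd i"
        then obtain j where j: "i = l * j" by (rule dvdE)
        then have "l * j < l * (n + 1)" using i assms by simp
        then have "j < n + 1" by (simp only: mult_less_cancel1)
        then have "j \<le> n" by simp
        then show False using i j by auto
      qed
      then show "dil l g $ i * f $ (l * n + r - i) = 0" using l by (simp add: dil_nth)
    qed
  qed simp
  also have "\<dots> = (\<Sum>j=0..n. g $ j * f $ (l * (n - j) + r))"
  proof (subst sum.reindex)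
    show "inj_on ((*) l) {0..n}" using l by (simp add: inj_on_def)
    show "(\<Sum>i=0..n. ((\<lambda>i. dil l g $ i * f $ (l * n + r - i)) \<circ> (*) l) i) = (\<Sum>j=0..n. g $ j * f $ (l * (n - j) + r))"
    proof (intro sum.cong refl)
      fix j assume "j \<in> {0..n}"
      then have "l * n + r - l * j = l * (n - j) + r" by (simp add: diff_mult_distrib2)
      then show "((\<lambda>i. dil l g $ i * f $ (l * n + r - i)) \<circ> (*) l) j = g $ j * f $ (l * (n - j) + r)"
        using l by (simp add: dil_nth)
    qed
  qed
  also have "\<dots> = (Abs_fps (\<lambda>n. f $ (l * n + r)) * g) $ n"
    unfolding mult.commute[of _ g] by (simp add: fps_mult_nth)
  finally show "Abs_fps (\<lambda>n. (f * dil l g) $ (l * n + r)) $ n = (Abs_fps (\<lambda>n. f $ (l * n + r)) * g) $ n"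
    by simp
qed

lemma p3_gf:
  assumes "l > 0"
  shows "Abs_fps (p3 l) = ieta3 * dil l ieta3"
proof -
  have "eta3 * dil l eta3 * Abs_fps (p3 l) = 1"
    using p3_generating_function[OF assms] by (simp only: dil_eta3[OF assms]) (simp only: eta3_def)
  moreover have "eta3 * dil l eta3 * (ieta3 * dil l ieta3) = (eta3 * ieta3) * (dil l eta3 * dil l ieta3)"
    by (simp only: ac_simps)
  moreover have "eta3 * dil l eta3 \<noteq> 0"
    using eta3_ieta3 dil_eta3_ieta3[OF assms] by auto
  ultimately show ?thesis using dil_eta3_ieta3[OF assms] eta3_ieta3 by (metis mult_1_left mult_left_cancel)
qed

definition section_index :: "nat \<Rightarrow> nat \<Rightarrow> nat \<Rightarrow> nat" where
  "section_index a b n = 3 ^ (2 * a + b + 1) * n + (4 * 3 ^ (2 * a + b + 1) + 3 ^ (2 * a + 1) + 1) div 8"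

lemma section_index_0: "section_index a 0 n = 3 ^ (2 * a + 1) * n + offset (3 ^ (2 * a + 1))"
  by (simp add: section_index_def offset_def)

lemma section_index_Suc: "section_index a (Suc b) n = section_index a b (3 * n + 1)"
proof -
  define x :: nat where "x = 3 ^ (2 * a + b + 1)"
  have "3 ^ (2 * a + Suc b + 1) = 3 * x" by (simp add: x_def)
  moreover have "(4 * (3 * x) + y + 1) div 8 = x + (4 * x + y + 1) div 8" for y by presburger
  ultimately show ?thesis unfolding section_index_def x_def[symmetric] by (simp add: algebra_simps)
qed

text \<open>At b = 0 the section with modulus l turns 1 / E(q^l)^3 into 1 / E(q)^3, which
  \<open>eta3\<close> cancels. Each further step divides by E(q)^3, selects the residue 1 and gains
  3.\<close>

lemma p3_section:
  "eta3 * dil 3 eta3 * (fps_X * Abs_fps (\<lambda>n. p3 (3 ^ (2 * a + 1)) (section_index a b n)))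
     \<in> zfps.span (tail_gen (3 * a + b + 2))"
proof (induction b)
  case 0
  define l :: nat where "l = 3 ^ (2 * a + 1)"
  have "l > 0" by (simp add: l_def)
  moreover have "(5 * x + 1) div 8 < x" if "x > 0" for x :: nat using that by presburger
  ultimately have "l > 0" "offset l < l" by (simp_all add: offset_def)
  have "p3 l n = (ieta3 * dil l ieta3) $ n" for n
    using p3_gf[OF \<open>l > 0\<close>] by (metis fps_nth_Abs_fps)
  then have "Abs_fps (\<lambda>n. p3 l (section_index a 0 n)) = Abs_fps (\<lambda>n. ieta3 $ (l * n + offset l)) * ieta3"
    using mult_dil_section[OF \<open>offset l < l\<close>, of ieta3 ieta3] unfolding section_index_0 l_def[symmetric] by simp
  then have E: "eta3 * dil 3 eta3 * (fps_X * Abs_fps (\<lambda>n. p3 l (section_index a 0 n))) =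
      dil 3 eta3 * (fps_X * Abs_fps (\<lambda>n. ieta3 $ (l * n + offset l))) * (eta3 * ieta3)"
    by (simp only: ac_simps)
  show ?case
    using ieta3_section[of a] unfolding l_def[symmetric] E eta3_ieta3 mult_1_right add_0_right .
next
  case (Suc b)
  define K where "K = Abs_fps (\<lambda>n. p3 (3 ^ (2 * a + 1)) (section_index a b n))"
  define \<phi> where "\<phi> = eta3 * dil 3 eta3 * (fps_X * K)"
  have \<phi>: "\<phi> \<in> zfps.span (tail_gen (3 * a + b + 2))" using Suc.IH by (simp only: \<phi>_def K_def)
  have "fps_X * ieta3 * \<phi> = dil 3 eta3 * (fps_X * (fps_X * K)) * (eta3 * ieta3)"
    unfolding \<phi>_def by (simp only: ac_simps)
  then have "trisect (fps_X * ieta3 * \<phi>) = eta3 * (fps_X * Abs_fps (\<lambda>n. K $ (3 * n + 1)))"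
    by (simp only: eta3_ieta3 mult_1_right trisect_dil_mult trisect_X_X_mult)
  then have E: "dil 3 eta3 * trisect (fps_X * ieta3 * \<phi>) =
      eta3 * dil 3 eta3 * (fps_X * Abs_fps (\<lambda>n. p3 (3 ^ (2 * a + 1)) (section_index a (Suc b) n)))"
    by (simp add: K_def section_index_Suc ac_simps)
  have "3 * a + b + 2 + 1 = 3 * a + Suc b + 2" by simp
  then show ?case using trisect_X_tail[OF \<phi>] unfolding E by (simp only:)
qed

section \<open>The congruences\<close>

text \<open>Modulo m the coefficient at 3n equals that at n, and those at indices prime to 3 vanish;
  descent covers every positive index.\<close>

lemma dil_3_fixed_mod_imp_const:
  fixes z h :: "int fps"
  assumes "z - dil 3 z = of_int m * h"
  shows "\<exists>g. z = fps_const (z $ 0) + of_int m * g"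
proof -
  have nth: "(of_int m * f) $ n = m * f $ n" for f :: "int fps" and n
    unfolding fps_of_int[symmetric] by (simp add: fps_mult_left_const_nth)
  have "m dvd z $ n" if "n > 0" for n
    using that
  proof (induction n rule: less_induct)
    case (less n)
    have "z $ n - dil 3 z $ n = m * h $ n" using arg_cong[OF assms, of "\<lambda>f. f $ n"] by (simp add: nth)
    moreover have "m dvd dil 3 z $ n"
    proof (cases "3 dvd n")
      case True
      then have "0 < n div 3" "n div 3 < n" using less.prems by auto
      then show ?thesis using less.IH by (simp add: dil_nth)
    qed (simp add: dil_nth)
    ultimately show ?case by (metis diff_add_cancel dvd_add dvd_triv_left)
  qed
  then have "z = fps_const (z $ 0) + of_int m * Abs_fps (\<lambda>n. if n = 0 then 0 else z $ n div m)"
    by (auto simp: fps_eq_iff nth)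
  then show ?thesis by blast
qed

text \<open>With \<open>u = E(q)^3\<close>, the norm identity gives \<open>u^3 E(q^9)^3 \<equiv> E(q^3)^12\<close> modulo 9, so \<open>u^3 / E(q^3)^3\<close> is
  invariant under \<open>q \<mapsto> q^3\<close> modulo 9 and hence constant.\<close>

lemma eta3_cubed_mod_9: "\<exists>g. eta3 ^ 3 = dil 3 eta3 * (1 + 9 * g)"
proof -
  define A B U V W W9 where "A = dil 3 (trisect eta3)" and "B = fps_X * dil 9 eta3" and "U = dil 3 eta3"
    and "V = dil 9 eta3" and "W = dil 3 ieta3" and "W9 = dil 9 ieta3"
  have UW: "U * W = 1" and VW9: "V * W9 = 1"
    unfolding U_def V_def W_def W9_def by (simp_all add: dil_eta3_ieta3)
  have u: "eta3 = A - 3 * B"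
    using eta3_dissection unfolding A_def B_def by (simp only: mult.assoc)
  have norm: "(A ^ 3 - 27 * B ^ 3) * V = U ^ 4"
    using eta3_norm unfolding A_def B_def U_def V_def by (simp only: power_mult_distrib mult.assoc)
  define z where "z = eta3 ^ 3 * W"
  \<comment> \<open>From (A - 3B)^3 - (A^3 - 27B^3) = 9 (3AB^2 - A^2 B).\<close>
  define h where "h = (3 * A * B ^ 2 - A ^ 2 * B) * W"
  have "dil 3 z = U ^ 3 * W9"
    by (simp add: z_def U_def W_def W9_def dil_dil)
  also have "\<dots> = U ^ 4 * W * W9"
  proof -
    have "U ^ 4 * W * W9 = U ^ 3 * W9 * (U * W)" by (simp add: eval_nat_numeral algebra_simps)
    then show ?thesis by (simp only: UW mult_1_right)
  qed
  also have "\<dots> = (A ^ 3 - 27 * B ^ 3) * W * (V * W9)"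
    unfolding norm[symmetric] by (simp only: ac_simps)
  finally have "z - dil 3 z = of_int 9 * h"
    unfolding VW9 z_def h_def u by (simp add: power3_eq_cube power2_eq_square algebra_simps)
  then obtain g where "z = fps_const (z $ 0) + of_int 9 * g"
    using dil_3_fixed_mod_imp_const by blast
  moreover have "z $ 0 = 1"
    by (simp add: z_def W_def eta3_def ieta3_def dil_nth fps_nth_power_0)
  ultimately have "z = 1 + 9 * g" by simp
  moreover have "eta3 ^ 3 = U * z"
  proof -
    have "U * z = eta3 ^ 3 * (U * W)" unfolding z_def by (simp only: ac_simps)
    then show ?thesis by (simp add: UW)
  qed
  ultimately show ?thesis unfolding U_def by blast
qed

lemma tail_mod_9:
  assumes "x \<in> zfps.span (tail_gen c)"
  shows "\<exists>k g. x = 3 ^ c * (of_int k * hauptmodul + 9 * g)"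
  using assms
proof (induction rule: zfps.span_induct_alt)
  case base
  show ?case by (rule exI[of _ 0], rule exI[of _ 0]) simp
next
  case (step m s y)
  then obtain j where s: "s = 3 ^ (c + 2 * j) * hauptmodul ^ (j + 1)" by (auto simp: tail_gen_def)
  from step.IH obtain k g where y: "y = 3 ^ c * (of_int k * hauptmodul + 9 * g)" by blast
  show ?case
  proof (cases j)
    case 0
    have "of_int m * s + y = 3 ^ c * (of_int (m + k) * hauptmodul + 9 * g)"
      unfolding s y 0 by (simp add: algebra_simps)
    then show ?thesis by blast
  next
    case (Suc i)
    have nine: "(3 :: int fps) ^ (c + 2 * Suc i) = 3 ^ c * (9 * 9 ^ i)"
      unfolding power_add power_mult by simp
    have "of_int m * s + y = 3 ^ c * (of_int k * hauptmodul + 9 * (g + of_int m * 9 ^ i * hauptmodul ^ (j + 1)))"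
      unfolding s y Suc nine by (simp add: algebra_simps)
    then show ?thesis by blast
  qed
qed

text \<open>With u = E(q)^3 and U = E(q^3)^3, the left side is q U^3 / u^5, and U^2 is congruent to
  u^6 modulo 9.\<close>

lemma hauptmodul_mod_9:
  "\<exists>g. ieta3 * dil 3 ieta3 * hauptmodul = fps_X * (eta3 * dil 3 eta3 + 9 * g)"
proof -
  obtain g where g: "eta3 ^ 3 = dil 3 eta3 * (1 + 9 * g)" using eta3_cubed_mod_9 by blast
  define U W where "U = dil 3 eta3" and "W = dil 3 ieta3"
  have UW: "U * W = 1" unfolding U_def W_def by (simp add: dil_eta3_ieta3)
  have "ieta3 * W * hauptmodul = fps_X * (U ^ 3 * ieta3 ^ 5) * (U * W)"
    unfolding hauptmodul_def U_def by (simp add: eval_nat_numeral algebra_simps)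
  also have "U ^ 3 * ieta3 ^ 5 = eta3 * U - U * ieta3 ^ 5 * ((eta3 ^ 3) ^ 2 - U ^ 2)"
  proof -
    have "U * ieta3 ^ 5 * (eta3 ^ 3) ^ 2 = eta3 * U * (eta3 * ieta3) ^ 5"
      by (simp add: power_mult_distrib eval_nat_numeral algebra_simps)
    then show ?thesis by (simp add: eta3_ieta3 eval_nat_numeral algebra_simps)
  qed
  also have "(eta3 ^ 3) ^ 2 - U ^ 2 = 9 * (U ^ 2 * (2 * g + 9 * g ^ 2))"
    unfolding g U_def[symmetric] by (simp add: power2_eq_square algebra_simps)
  also have "fps_X * (eta3 * U - U * ieta3 ^ 5 * (9 * (U ^ 2 * (2 * g + 9 * g ^ 2)))) * (U * W)
     = fps_X * (eta3 * U + 9 * (- U * ieta3 ^ 5 * (U ^ 2 * (2 * g + 9 * g ^ 2))))"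
    unfolding UW by (simp add: algebra_simps)
  finally show ?thesis unfolding U_def W_def by blast
qed

lemma power_3_mult_nth: "(3 ^ c * f) $ n = 3 ^ c * (f :: int fps) $ n"
proof -
  have "(3 ^ c :: int fps) = fps_const (3 ^ c)" by (simp add: fps_numeral_fps_const)
  then show ?thesis by (simp only: fps_mult_left_const_nth)
qed

text \<open>Divide \<open>p3_section\<close>, reduced by \<open>tail_mod_9\<close>, by E(q)^3
  E(q^3)^3 and insert \<open>hauptmodul_mod_9\<close>. The common factor q is why coefficients are
  compared at n + 1.\<close>

lemma p3_index_mod:
  "\<exists>k m. p3 (3 ^ (2 * a + 1)) (section_index a b n) =
     3 ^ (3 * a + b + 2) * (k * (eta3 * dil 3 eta3) $ n + 9 * m)"
proof -
  define c where "c = 3 * a + b + 2"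
  define K where "K = Abs_fps (\<lambda>n. p3 (3 ^ (2 * a + 1)) (section_index a b n))"
  obtain k g where E: "eta3 * dil 3 eta3 * (fps_X * K) = 3 ^ c * (of_int k * hauptmodul + 9 * g)"
    using tail_mod_9[OF p3_section[of a b]] unfolding c_def K_def by blast
  obtain h where h: "ieta3 * dil 3 ieta3 * hauptmodul = fps_X * (eta3 * dil 3 eta3 + 9 * h)"
    using hauptmodul_mod_9 by blast
  have "fps_X * K = (eta3 * ieta3) * (dil 3 eta3 * dil 3 ieta3) * (fps_X * K)"
    by (simp add: eta3_ieta3 dil_eta3_ieta3)
  also have "\<dots> = ieta3 * dil 3 ieta3 * (eta3 * dil 3 eta3 * (fps_X * K))"
    by (simp only: ac_simps)
  also have "\<dots> = 3 ^ c * (of_int k * (ieta3 * dil 3 ieta3 * hauptmodul) + 9 * (ieta3 * dil 3 ieta3 * g))"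
    unfolding E by (simp add: algebra_simps)
  also have "\<dots> = 3 ^ c * (of_int k * (fps_X * (eta3 * dil 3 eta3)) + of_int 9 * (of_int k * (fps_X * h) + ieta3 * dil 3 ieta3 * g))"
    unfolding h by (simp add: algebra_simps)
  finally have XK: "fps_X * K = 3 ^ c * (of_int k * (fps_X * (eta3 * dil 3 eta3)) + of_int 9 * (of_int k * (fps_X * h) + ieta3 * dil 3 ieta3 * g))" .
  have nth: "(of_int i * f) $ n = i * f $ n" for f :: "int fps" and n i
    unfolding fps_of_int[symmetric] by (simp add: fps_mult_left_const_nth)
  have "K $ n = (fps_X * K) $ (n + 1)" by simp
  also have "\<dots> = 3 ^ c * (k * (eta3 * dil 3 eta3) $ n + 9 * (of_int k * (fps_X * h) + ieta3 * dil 3 ieta3 * g) $ (n + 1))"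
    unfolding XK power_3_mult_nth fps_add_nth nth by simp
  finally have Kn: "p3 (3 ^ (2 * a + 1)) (section_index a b n) =
      3 ^ c * (k * (eta3 * dil 3 eta3) $ n + 9 * (of_int k * (fps_X * h) + ieta3 * dil 3 ieta3 * g) $ (n + 1))"
    unfolding K_def fps_nth_Abs_fps .
  show ?thesis unfolding c_def[symmetric] by (intro exI) (rule Kn)
qed

section \<open>Exponents of E(q)^3 E(q^3)^3 and the form x^2 + 3 y^2\<close>

lemma eta3_product_support:
  assumes "(eta3 * dil 3 eta3) $ n \<noteq> 0"
  obtains x y :: int where "8 * int n + 4 = x\<^sup>2 + 3 * y\<^sup>2"
proof -
  have "\<exists>i\<in>{0..n}. eta3 $ i * dil 3 eta3 $ (n - i) \<noteq> 0"
    using assms unfolding fps_mult_nth by (meson sum.neutral)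
  then obtain i where i: "i \<le> n" "eta3 $ i \<noteq> 0" "dil 3 eta3 $ (n - i) \<noteq> 0" by auto
  obtain j where j: "i = tri j" using i(2) jacobi_non_tri[of i] unfolding eta3_def by blast
  have d: "3 dvd n - i" and "eta3 $ ((n - i) div 3) \<noteq> 0"
    using i(3) by (auto simp: dil_nth split: if_splits)
  then obtain j' where j': "(n - i) div 3 = tri j'" using jacobi_non_tri[of "(n - i) div 3"] unfolding eta3_def by blast
  have "n = tri j + 3 * tri j'" using i(1) d j j' by auto
  then have "8 * n + 4 = (8 * tri j + 1) + 3 * (8 * tri j' + 1)" by simp
  also have "\<dots> = (2 * j + 1)\<^sup>2 + 3 * (2 * j' + 1)\<^sup>2" by (simp only: eight_tri)
  finally have "int (8 * n + 4) = int ((2 * j + 1)\<^sup>2 + 3 * (2 * j' + 1)\<^sup>2)" by (rule arg_cong)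
  then show ?thesis by (intro that[of "int (2 * j + 1)" "int (2 * j' + 1)"]) simp
qed

lemma prime_dvd_norm_form:
  fixes p x y :: int
  assumes "prime p" "Legendre (- 3) p = - 1" "p dvd x\<^sup>2 + 3 * y\<^sup>2"
  shows "p dvd x \<and> p dvd y"
proof -
  have "p dvd y"
  proof (rule ccontr)
    assume "\<not> p dvd y"
    then have "coprime y p" using assms(1) by (metis coprime_commute prime_imp_coprime)
    \<comment> \<open>With \<open>y'\<close> inverse to y modulo p, the product x y' would be a
      square root of -3.\<close>
    then obtain y' where y': "[y * y' = 1] (mod p)" by (meson cong_solve_coprime_int)
    have "[x\<^sup>2 = - 3 * y\<^sup>2] (mod p)" using assms(3) by (simp add: cong_iff_dvd_diff)
    then have "[x\<^sup>2 * y'\<^sup>2 = - 3 * y\<^sup>2 * y'\<^sup>2] (mod p)" by (rule cong_scalar_right)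
    then have "[(x * y')\<^sup>2 = - 3 * (y * y')\<^sup>2] (mod p)" by (simp add: power_mult_distrib ac_simps)
    moreover have "[- 3 * (y * y')\<^sup>2 = - 3 * 1\<^sup>2] (mod p)"
      by (intro cong_scalar_left cong_pow y')
    ultimately have "[(x * y')\<^sup>2 = - 3] (mod p)" using cong_trans by fastforce
    then have "QuadRes p (- 3)" unfolding QuadRes_def by blast
    then show False using assms(2) by (auto simp: Legendre_def split: if_splits)
  qed
  moreover from this have "p dvd x\<^sup>2" using assms(3) by (simp add: dvd_add_left_iff power2_eq_square)
  then have "p dvd x" using assms(1) prime_dvd_power by blast
  ultimately show ?thesis by simp
qed

text \<open>Descent: p divides x and y, so p^2 can be divided out of both sides until a single p is
  left, and then p^2 divides p r.\<close>

lemma norm_form_odd_power: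
  fixes p x y r :: int
  assumes p: "prime p" "Legendre (- 3) p = - 1" and "x\<^sup>2 + 3 * y\<^sup>2 = p ^ (2 * k + 1) * r"
  shows "p dvd r"
  using assms(3)
proof (induction k arbitrary: x y)
  case 0
  then have "p dvd x" "p dvd y" using prime_dvd_norm_form[OF p, of x y] by simp_all
  then obtain x' y' where "x = p * x'" "y = p * y'" by (meson dvdE)
  with 0 have "p * (p * (x'\<^sup>2 + 3 * y'\<^sup>2)) = p * r" by (simp add: power2_eq_square algebra_simps)
  then have "p * (x'\<^sup>2 + 3 * y'\<^sup>2) = r" using p(1) by simp
  then show ?case by auto
next
  case (Suc k)
  then have "p dvd x" "p dvd y" using prime_dvd_norm_form[OF p, of x y] by simp_all
  then obtain x' y' where "x = p * x'" "y = p * y'" by (meson dvdE)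
  with Suc.prems have "p\<^sup>2 * (x'\<^sup>2 + 3 * y'\<^sup>2) = p\<^sup>2 * (p ^ (2 * k + 1) * r)"
    by (simp add: power2_eq_square algebra_simps)
  then have "x'\<^sup>2 + 3 * y'\<^sup>2 = p ^ (2 * k + 1) * r" using p(1) by simp
  then show ?case by (rule Suc.IH)
qed

theorem theorem1p5:
  fixes \<alpha> \<beta> k :: nat
  shows "(\<forall>n::nat.
            [p3 (3 ^ (2 * \<alpha> + 1))
                (3 ^ (2 * \<alpha> + \<beta> + 1) * n
                  + (4 * 3 ^ (2 * \<alpha> + \<beta> + 1) + 3 ^ (2 * \<alpha> + 1) + 1) div 8) = 0]
            (mod 3 ^ (3 * \<alpha> + \<beta> + 2)))
       \<and> (\<forall>(p::nat) (n::nat). prime p \<and> odd p \<and> Legendre (- 3) (int p) = - 1 \<and> \<not> p dvd n \<longrightarrow>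
            [p3 (3 ^ (2 * \<alpha> + 1))
                (3 ^ (2 * \<alpha> + \<beta> + 1) * p ^ (2 * k + 1) * n
                  + (4 * p ^ (2 * k + 2) * 3 ^ (2 * \<alpha> + \<beta> + 1) + 3 ^ (2 * \<alpha> + 1) + 1) div 8) = 0]
            (mod 3 ^ (3 * \<alpha> + \<beta> + 4)))"
proof (intro conjI allI impI)
  fix n
  show "[p3 (3 ^ (2 * \<alpha> + 1))
          (3 ^ (2 * \<alpha> + \<beta> + 1) * n + (4 * 3 ^ (2 * \<alpha> + \<beta> + 1) + 3 ^ (2 * \<alpha> + 1) + 1) div 8) = 0]
        (mod 3 ^ (3 * \<alpha> + \<beta> + 2))"
    using p3_index_mod[of \<alpha> \<beta> n] unfolding section_index_def cong_0_iff by auto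
next
  fix p n :: nat
  assume "prime p \<and> odd p \<and> Legendre (- 3) (int p) = - 1 \<and> \<not> p dvd n"
  then have p: "prime p" "odd p" "Legendre (- 3) (int p) = - 1" "\<not> p dvd n" by simp_all
  \<comment> \<open>Since 4 p^(2k+2) L = 4L + 8hL, the index in the theorem is the index of the
    first congruence taken at \<open>m\<close>.\<close>
  obtain h where h: "p ^ (2 * k + 2) = 2 * h + 1" using p(2) by (metis even_power oddE)
  define m where "m = p ^ (2 * k + 1) * n + h"
  define L :: nat where "L = 3 ^ (2 * \<alpha> + \<beta> + 1)"
  have "4 * p ^ (2 * k + 2) * L + y + 1 = (4 * L + y + 1) + 8 * (h * L)" for y
    unfolding h by (simp add: algebra_simps)
  then have idx: "L * p ^ (2 * k + 1) * n + (4 * p ^ (2 * k + 2) * L + 3 ^ (2 * \<alpha> + 1) + 1) div 8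
      = section_index \<alpha> \<beta> m"
    unfolding section_index_def L_def[symmetric] m_def by (simp add: algebra_simps)
  have zero: "(eta3 * dil 3 eta3) $ m = 0"
  proof (rule ccontr)
    assume "(eta3 * dil 3 eta3) $ m \<noteq> 0"
    then obtain x y :: int where xy: "8 * int m + 4 = x\<^sup>2 + 3 * y\<^sup>2" by (rule eta3_product_support)
    \<comment> \<open>Here 8m + 4 = 4 p^(2k+1) (2n + p), and p does not divide 4 (2n + p), as it is
      odd and prime to n. So p occurs to an odd power, which the form excludes.\<close>
    have "8 * m + 4 = 4 * (2 * (p ^ (2 * k + 1) * n) + (2 * h + 1))"
      by (simp add: m_def)
    also have "\<dots> = p ^ (2 * k + 1) * (4 * (2 * n + p))"
      unfolding h[symmetric] by (simp add: algebra_simps)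
    finally have "int (8 * m + 4) = int (p ^ (2 * k + 1) * (4 * (2 * n + p)))" by (rule arg_cong)
    then have "x\<^sup>2 + 3 * y\<^sup>2 = int p ^ (2 * k + 1) * int (4 * (2 * n + p))"
      using xy by simp
    then have "int p dvd int (4 * (2 * n + p))"
      using p by (intro norm_form_odd_power[of "int p"]) auto
    then have "p dvd 2 ^ 2 * (2 * n + p)" by (simp only: int_dvd_int_iff) simp
    moreover have "\<not> p dvd 2 ^ 2"
      using p(1,2) by (metis dvd_refl even_numeral prime_dvd_power primes_dvd_imp_eq two_is_prime_nat)
    ultimately have "p dvd 2 * n" using p(1) by (metis dvd_add_times_triv_right_iff mult_1 prime_dvd_mult_iff)
    then have "p dvd 2 \<or> p dvd n" using p(1) by (simp add: prime_dvd_mult_iff)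
    then show False using p by (metis primes_dvd_imp_eq two_is_prime_nat dvd_refl)
  qed
  \<comment> \<open>With the coefficient at \<open>m\<close> zero, only the term with 9 remains; it
    supplies the two additional powers of 3.\<close>
  obtain k' m' where "p3 (3 ^ (2 * \<alpha> + 1)) (section_index \<alpha> \<beta> m) = 3 ^ (3 * \<alpha> + \<beta> + 2) * (k' * (eta3 * dil 3 eta3) $ m + 9 * m')"
    using p3_index_mod by blast
  then have "p3 (3 ^ (2 * \<alpha> + 1)) (section_index \<alpha> \<beta> m) = 3 ^ (3 * \<alpha> + \<beta> + 4) * m'"
    unfolding zero by (simp add: power_add)
  then show "[p3 (3 ^ (2 * \<alpha> + 1))
          (3 ^ (2 * \<alpha> + \<beta> + 1) * p ^ (2 * k + 1) * n
            + (4 * p ^ (2 * k + 2) * 3 ^ (2 * \<alpha> + \<beta> + 1) + 3 ^ (2 * \<alpha> + 1) + 1) div 8) = 0]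
        (mod 3 ^ (3 * \<alpha> + \<beta> + 4))"
    unfolding cong_0_iff using idx unfolding L_def by simp
qed

end
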